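(* Let $\Theta$, $f_1,\dots,f_m$, $w\in\Delta_m$, $\mathrm{TCH}(\cdot\,;w)$, the constants $U,L,R_\theta$ and the stochastic gradients be as in the context; in particular each $f_i$ is convex with $f_i\le U$ and $\|\nabla f_i\|_\infty\le L$ on $\Theta$, and $\|\theta\|_\infty\le R_\theta$ for all $\theta\in\Theta$. Use projected gradient descent (PGD) for both $\theta$ and $\lambda$, i.e. online mirror descent with $\psi_\theta=\frac12\|\cdot\|_2^2$ and $\psi_\lambda=\frac12\|\cdot\|_2^2$. Then the associated constants (defined in the context) can be taken as $\mu_\theta=\mu_\lambda=1$, $D_\theta=2dR_\theta^2$, $D_\lambda=2$, $C_\theta=d$, $C_\lambda=m$. Consequently, with step sizes $\eta_\theta=\sqrt{\frac{8R_\theta^2}{5TL^2}}$ and $\eta_\lambda=\sqrt{\frac{8}{5TmU^2}}$, for $\hat\theta$ either the uniformly averaged output $\bar\theta$ or the adaptively averaged output $\tilde\theta$, and for every $0<\gamma<1$, with probability at least $1-\gamma$, $$\mathrm{TCH}(\hat\theta;w)-\min_{\theta\in\Theta}\mathrm{TCH}(\theta;w)\le\frac{2\sqrt{10}\,dR_\theta L}{\sqrt T}+\frac{2\sqrt{10}\sqrt m\,U}{\sqrt T}+4(dR_\theta L+U)\sqrt{\frac2T\log\frac1\gamma}.$$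
   Context: Problem. $d,m,T\ge1$ are integers, $\Delta_m=\{\alpha\in\mathbb{R}^m:\sum_i\alpha_i=1,\ \alpha_i\ge0\}$. $\Theta\subset\mathbb{R}^d$ is nonempty, closed and convex; $f_1,\dots,f_m:\mathbb{R}^d\to\mathbb{R}$ are differentiable and nonnegative on $\Theta$. For $w\in\Delta_m$, $\mathrm{TCH}(\theta;w)=\max_{i\in[m]}w_if_i(\theta)$ and $\mathcal{L}(\theta,\lambda;w)=\sum_{i=1}^m\lambda_iw_if_i(\theta)$ for $\lambda\in\Delta_m$. Assumption. There are constants $U,L,R_\theta>0$ such that for all $i\in[m]$ and $\theta\in\Theta$: $f_i$ is convex on $\Theta$, $f_i(\theta)\le U$, $\|\nabla f_i(\theta)\|_\infty\le L$, $\|\theta\|_\infty\le R_\theta$. Stochastic gradients. In each round $t$, for each objective $i$ a random batch of its training data is drawn (fresh in each round), giving random estimates $\delta f_i(\theta^{(t)})\in\mathbb{R}^d$ of $\nabla f_i(\theta^{(t)})$ and $\hat f_i^{(t)}\in\mathbb{R}$ of $f_i(\theta^{(t)})$ (batch averages of per-sample gradients and losses), whose conditional expectations given all batches of rounds $1,\dots,t-1$ are $\nabla f_i(\theta^{(t)})$ and $f_i(\theta^{(t)})$. Put $g_\theta^{(t)}=\sum_i\lambda_i^{(t)}w_i\,\delta f_i(\theta^{(t)})$ and $g_\lambda^{(t)}=(w_i\hat f_i^{(t)})_{i=1}^m$; these are conditionally unbiased for $\nabla_\theta\mathcal{L}(\theta^{(t)},\lambda^{(t)};w)$ and $\nabla_\lambda\mathcal{L}(\theta^{(t)},\lambda^{(t)};w)$,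 and $\|g_\theta^{(t)}\|_\infty\le L$, $\|g_\lambda^{(t)}\|_\infty\le U$. Updates (PGD/PGD). With $\Pi_X$ the Euclidean projection onto $X$, a deterministic $\theta^{(1)}\in\Theta$ and $\lambda^{(1)}=(1/m,\dots,1/m)$: $\theta^{(t+1)}=\Pi_\Theta(\theta^{(t)}-\eta_\theta g_\theta^{(t)})$, $\lambda^{(t+1)}=\Pi_{\Delta_m}(\lambda^{(t)}+\eta_\lambda g_\lambda^{(t)})$ for $t=1,\dots,T$. Outputs. The uniform conversion (OMD-TCH) outputs $\bar\theta=\frac1T\sum_{t=1}^T\theta^{(t)}$. Adaptive conversion (AdaOMD-TCH): say $\theta\preceq\theta'$ ($\theta$ dominates $\theta'$) if $f_i(\theta)\le f_i(\theta')$ for all $i$ and $f_j(\theta)<f_j(\theta')$ for some $j$. Maintain a set $P^{(t)}$ of iterates with weights $\gamma^{(t)}$, starting from $P^{(0)}=\emptyset$. In round $t$ let $A=\{\theta^{(\tau)}\in P^{(t-1)}:\theta^{(\tau)}\preceq\theta^{(t)}\}$. If $A\neq\emptyset$, keep $P^{(t)}=P^{(t-1)}$ and the weights, except that each element of $A$ has its weight increased by $1/|A|$. If $A=\emptyset$, let $B=\{\theta^{(\tau)}\in P^{(t-1)}:\theta^{(t)}\preceq\theta^{(\tau)}\}$, remove $B$ from the set, and add $\theta^{(t)}$ with weight $1$ plus the sum of the weights of the elements of $B$. Iterates are indexed by their round, and dominance uses the true objectives. The output is $\tilde\theta=\frac1T\sum_{\theta^{(\tau)}\in P^{(T)}}\gamma_\tau^{(T)}\theta^{(\tau)}$.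 Associated constants. For a differentiable $\psi$, $B_\psi(x;y)=\psi(x)-\psi(y)-\langle\nabla\psi(y),x-y\rangle$. $\mu_\theta$ (resp. $\mu_\lambda$) is a strong convexity constant of $\psi_\theta$ (resp. $\psi_\lambda$) with respect to a norm $\|\cdot\|_\theta$ (resp. $\|\cdot\|_\lambda$), here both $\|\cdot\|_2$, with dual norms $\|\cdot\|_{\theta,*},\|\cdot\|_{\lambda,*}$. With $\bar\lambda=\frac1T\sum_t\lambda^{(t)}$, $\theta^*\in\arg\min_{\theta\in\Theta}\mathcal{L}(\theta,\bar\lambda;w)$ and $\lambda^*\in\arg\max_{\lambda\in\Delta_m}\mathcal{L}(\hat\theta,\lambda;w)$, the constants must satisfy $B_{\psi_\theta}(\theta^*;\theta^{(1)})\le D_\theta$, $B_{\psi_\lambda}(\lambda^*;\lambda^{(1)})\le D_\lambda$, and for all $t$, $\|\cdot\|_{\theta,*}^2\le C_\theta L^2$ for both $\nabla_\theta\mathcal{L}(\theta^{(t)},\lambda^{(t)};w)$ and $g_\theta^{(t)}$, and $\|\cdot\|_{\lambda,*}^2\le C_\lambda U^2$ for both $\nabla_\lambda\mathcal{L}(\theta^{(t)},\lambda^{(t)};w)$ and $g_\lambda^{(t)}$. *)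

theory Defs
  imports "HOL-Probability.Probability"
begin

text \<open>The objectives are indexed by the finite type \<open>'m\<close> (so \<open>m = CARD('m)\<close>) and the
  parameters live in \<open>real ^ 'd\<close> (so \<open>d = CARD('d)\<close>).\<close>

definition simplex_set :: "(real ^ 'm) set" where
  "simplex_set = {\<alpha>. (\<Sum>i\<in>UNIV. \<alpha> $ i) = 1 \<and> (\<forall>i. 0 \<le> \<alpha> $ i)}"

definition TCH :: "('m::finite \<Rightarrow> 'a \<Rightarrow> real) \<Rightarrow> real ^ 'm \<Rightarrow> 'a \<Rightarrow> real" where
  "TCH f w x = (MAX i. w $ i * f i x)"

definition lagrangian :: "('m::finite \<Rightarrow> 'a \<Rightarrow> real) \<Rightarrow> real ^ 'm \<Rightarrow> 'a \<Rightarrow> real ^ 'm \<Rightarrow> real" where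
  "lagrangian f w x \<alpha> = (\<Sum>i\<in>UNIV. \<alpha> $ i * w $ i * f i x)"

text \<open>Only meaningful at points where the function is differentiable.\<close>

definition gradient :: "('a::real_inner \<Rightarrow> real) \<Rightarrow> 'a \<Rightarrow> 'a" where
  "gradient \<phi> x = (THE D. GDERIV \<phi> x :> D)"

definition bregman :: "('a::real_inner \<Rightarrow> real) \<Rightarrow> 'a \<Rightarrow> 'a \<Rightarrow> real" where
  "bregman \<psi> x y = \<psi> x - \<psi> y - gradient \<psi> y \<bullet> (x - y)"

text \<open>In the next two definitions \<open>N\<close> is an arbitrary norm on the space, not necessarily
  the one of the type class.\<close>

definition strongly_convex ::
    "('a::real_vector \<Rightarrow> real) \<Rightarrow> ('a \<Rightarrow> real) \<Rightarrow> real \<Rightarrow> bool" where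
  "strongly_convex \<psi> N \<mu> \<longleftrightarrow>
     (\<forall>x y u. 0 \<le> u \<and> u \<le> 1 \<longrightarrow>
        \<psi> (u *\<^sub>R x + (1 - u) *\<^sub>R y)
          \<le> u * \<psi> x + (1 - u) * \<psi> y - \<mu> / 2 * u * (1 - u) * (N (x - y))\<^sup>2)"

definition dual_norm :: "('a::real_inner \<Rightarrow> real) \<Rightarrow> 'a \<Rightarrow> real" where
  "dual_norm N y = (SUP x\<in>{x. N x \<le> 1}. x \<bullet> y)"


text \<open>The \<open>\<sigma>\<close>-algebra generated by the batches of rounds \<open>1, \<dots>, t\<close>, where \<open>\<xi> s i\<close> is the batch
  drawn for objective \<open>i\<close> in round \<open>s\<close> and \<open>Z i\<close> is the space of batches of objective \<open>i\<close>.
  It is trivial for \<open>t = 0\<close>.\<close>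

definition history ::
    "'w measure \<Rightarrow> ('m \<Rightarrow> 'z measure) \<Rightarrow> (nat \<Rightarrow> 'm \<Rightarrow> 'w \<Rightarrow> 'z) \<Rightarrow> nat \<Rightarrow> 'w measure" where
  "history M Z \<xi> t =
     sigma (space M) {\<xi> s i -` A \<inter> space M | s i A. s \<in> {1..t} \<and> A \<in> sets (Z i)}"

text \<open>Below, \<open>\<delta> i\<close> is the estimate of the gradient of the \<open>i\<close>-th objective and \<open>v i\<close> the
  estimate of its value.\<close>

definition stoch_grad_theta ::
    "real ^ 'm \<Rightarrow> real ^ 'm \<Rightarrow> ('m::finite \<Rightarrow> real ^ 'd) \<Rightarrow> real ^ 'd" where
  "stoch_grad_theta w \<alpha> \<delta> = (\<Sum>i\<in>UNIV. (\<alpha> $ i * w $ i) *\<^sub>R \<delta> i)"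

definition stoch_grad_lam :: "real ^ 'm \<Rightarrow> ('m::finite \<Rightarrow> real) \<Rightarrow> real ^ 'm" where
  "stoch_grad_lam w v = (\<chi> i. w $ i * v i)"


definition uniform_average :: "nat \<Rightarrow> (nat \<Rightarrow> 'a::real_vector) \<Rightarrow> 'a" where
  "uniform_average T x = (1 / real T) *\<^sub>R (\<Sum>t=1..T. x t)"

definition dominates :: "('m \<Rightarrow> 'a \<Rightarrow> real) \<Rightarrow> 'a \<Rightarrow> 'a \<Rightarrow> bool" where
  "dominates f x y \<longleftrightarrow> (\<forall>i. f i x \<le> f i y) \<and> (\<exists>j. f j x < f j y)"

text \<open>The set of retained iterates, represented by the set of their rounds, together with the
  weights.  Weights of rounds outside this set are irrelevant.\<close>

fun adaptive_state ::
    "('m \<Rightarrow> 'a \<Rightarrow> real) \<Rightarrow> (nat \<Rightarrow> 'a) \<Rightarrow> nat \<Rightarrow> nat set \<times> (nat \<Rightarrow> real)" where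
  "adaptive_state f x 0 = ({}, \<lambda>_. 0)"
| "adaptive_state f x (Suc t) =
     (let (P, \<gamma>) = adaptive_state f x t;
          A = {\<tau> \<in> P. dominates f (x \<tau>) (x (Suc t))};
          B = {\<tau> \<in> P. dominates f (x (Suc t)) (x \<tau>)}
      in if A \<noteq> {}
         then (P, \<lambda>\<tau>. if \<tau> \<in> A then \<gamma> \<tau> + 1 / real (card A) else \<gamma> \<tau>)
         else (insert (Suc t) (P - B), \<gamma>(Suc t := 1 + (\<Sum>\<tau>\<in>B. \<gamma> \<tau>))))"

definition adaptive_average ::
    "('m \<Rightarrow> 'a \<Rightarrow> real) \<Rightarrow> nat \<Rightarrow> (nat \<Rightarrow> 'a::real_vector) \<Rightarrow> 'a" where
  "adaptive_average f T x =
     (let (P, \<gamma>) = adaptive_state f x T in (1 / real T) *\<^sub>R (\<Sum>\<tau>\<in>P. \<gamma> \<tau> *\<^sub>R x \<tau>))"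


text \<open>The constants entering the analysis of online mirror descent with distance generating
  functions \<open>\<psi>_theta\<close>, \<open>\<psi>_lam\<close> and norms \<open>N_theta\<close>, \<open>N_lam\<close>.  The process arguments are the iterates
  \<open>\<theta>\<close> and \<open>lam\<close>, the output \<open>\<theta>hat\<close> and the stochastic gradients \<open>g_theta\<close> and \<open>g_lam\<close>.\<close>

definition associated_constants ::
    "'w measure \<Rightarrow> ('m::finite \<Rightarrow> real ^ 'd \<Rightarrow> real) \<Rightarrow> real ^ 'm \<Rightarrow> (real ^ 'd) set \<Rightarrow>
     real \<Rightarrow> real \<Rightarrow> nat \<Rightarrow>
     (nat \<Rightarrow> 'w \<Rightarrow> real ^ 'd) \<Rightarrow> (nat \<Rightarrow> 'w \<Rightarrow> real ^ 'm) \<Rightarrow> ('w \<Rightarrow> real ^ 'd) \<Rightarrow>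
     (nat \<Rightarrow> 'w \<Rightarrow> real ^ 'd) \<Rightarrow> (nat \<Rightarrow> 'w \<Rightarrow> real ^ 'm) \<Rightarrow>
     (real ^ 'd \<Rightarrow> real) \<Rightarrow> (real ^ 'd \<Rightarrow> real) \<Rightarrow> (real ^ 'm \<Rightarrow> real) \<Rightarrow> (real ^ 'm \<Rightarrow> real) \<Rightarrow>
     real \<Rightarrow> real \<Rightarrow> real \<Rightarrow> real \<Rightarrow> real \<Rightarrow> real \<Rightarrow> bool" where
  "associated_constants M f w \<Theta> U L T \<theta> lam \<theta>hat g_theta g_lam
       \<psi>_theta N_theta \<psi>_lam N_lam \<mu>_theta \<mu>_lam D_theta D_lam C_theta C_lam \<longleftrightarrow>
     0 < \<mu>_theta \<and> strongly_convex \<psi>_theta N_theta \<mu>_theta \<and>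
     0 < \<mu>_lam \<and> strongly_convex \<psi>_lam N_lam \<mu>_lam \<and>
     (\<forall>\<omega>\<in>space M. \<forall>\<theta>_star.
        is_arg_min (\<lambda>x. lagrangian f w x (uniform_average T (\<lambda>t. lam t \<omega>))) (\<lambda>x. x \<in> \<Theta>) \<theta>_star
        \<longrightarrow> bregman \<psi>_theta \<theta>_star (\<theta> 1 \<omega>) \<le> D_theta) \<and>
     (\<forall>\<omega>\<in>space M. \<forall>lam_star.
        is_arg_max (\<lambda>\<alpha>. lagrangian f w (\<theta>hat \<omega>) \<alpha>) (\<lambda>\<alpha>. \<alpha> \<in> simplex_set) lam_star
        \<longrightarrow> bregman \<psi>_lam lam_star (lam 1 \<omega>) \<le> D_lam) \<and>
     (\<forall>t\<in>{1..T}.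
        (\<forall>\<omega>\<in>space M.
           (dual_norm N_theta (gradient (\<lambda>x. lagrangian f w x (lam t \<omega>)) (\<theta> t \<omega>)))\<^sup>2 \<le> C_theta * L\<^sup>2 \<and>
           (dual_norm N_lam (gradient (\<lambda>\<alpha>. lagrangian f w (\<theta> t \<omega>) \<alpha>) (lam t \<omega>)))\<^sup>2 \<le> C_lam * U\<^sup>2) \<and>
        (AE \<omega> in M. (dual_norm N_theta (g_theta t \<omega>))\<^sup>2 \<le> C_theta * L\<^sup>2 \<and>
                    (dual_norm N_lam (g_lam t \<omega>))\<^sup>2 \<le> C_lam * U\<^sup>2))"

end

theory Submission
  imports Defs
begin

text \<open>Dominance and convexity give, for either output \<open>\<theta>hat\<close>, that each \<open>f i (\<theta>hat)\<close> is at most the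
  average of \<open>f i\<close> over the iterates, so the gap is bounded by the sum of the average regrets of the two
  players, measured with the true gradients. The comparators depend on the whole trajectory, so the
  gradient noise cannot be paired with them directly. Instead each player is accompanied by a ghost
  sequence, driven by projected gradient steps along the noise itself: the regret of the ghost
  sequence is bounded deterministically, and what remains is a sum of bounded martingale differences,
  to which the Azuma--Hoeffding inequality applies.\<close>

section \<open>The Azuma--Hoeffding inequality\<close>

text \<open>The constants come from the ghost sequences. With gradients of sup norm at most
  \<open>K\<close> in dimension \<open>n\<close>, a player started within half squared distance
  \<open>D\<close> of every comparator has regret at most
  \<open>D / \<eta> + \<eta> / 2 * T * n * K^2\<close>. Its ghost is driven by noise of sup norm up
  to \<open>2 * K\<close> and costs the same with \<open>4 * K^2\<close>. The sum is
  \<open>2 * D / \<eta> + 5 / 2 * \<eta> * T * n * K^2\<close>; the prescribed step sizes minimise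
  it, and its minimum carries the factor \<open>2 * sqrt 10\<close>.

  The martingale increments pair noise of sup norm at most \<open>2 * L\<close> or
  \<open>2 * U\<close> with the difference of two feasible points. Duality of sup norm and l1 norm
  is the right tool here: the l1 diameters are at most \<open>2 * d * R\<close> for \<Theta> and 2
  for the simplex, which gives \<open>4 * d * R * L\<close> and \<open>4 * U\<close>, the latter
  without any power of \<open>m\<close>.

  Both players live on the same filtration, so their increments are added before the tail bound is
  applied. There is a single exceptional event and no union bound, hence the logarithm of
  \<open>1 / \<gamma>\<close> rather than of \<open>2 / \<gamma>\<close>.\<close>

lemma cosh_real_le_exp: "cosh (x::real) \<le> exp (x\<^sup>2 / 2)"
proof -
  have "cosh x \<le> exp (x\<^sup>2 / 2)" if "0 \<le> x" for x :: real
  proof -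
    \<comment> \<open>The left side is \<open>ln (cosh x)\<close>: it is the function of Hoeffding's
      lemma at \<open>h = 2 * x\<close> and \<open>p = 1 / 2\<close>, and \<open>h^2 / 8\<close> is
      \<open>x^2 / 2\<close>. Evenness of both sides later removes the sign condition.\<close>
    have "- x + ln (1 + (exp (2 * x) - 1) / 2) \<le> (2 * x)\<^sup>2 / 8"
      using Hoeffdings_lemma_aux[of "2 * x" "1 / 2"] that by simp
    then have le: "exp (- x + ln (1 + (exp (2 * x) - 1) / 2)) \<le> exp (x\<^sup>2 / 2)"
      by (simp add: power2_eq_square)
    have "0 < 1 + (exp (2 * x) - 1) / 2"
      by (simp add: field_simps add_pos_pos)
    then have "exp (- x + ln (1 + (exp (2 * x) - 1) / 2)) = exp (- x) * (1 + (exp (2 * x) - 1) / 2)"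
      unfolding exp_add by simp
    also have "\<dots> = cosh x"
      by (simp add: cosh_def field_simps flip: exp_add)
    finally show ?thesis using le by simp
  qed
  from this[of "\<bar>x\<bar>"] show ?thesis by simp
qed

text \<open>The right side is the chord of \<open>exp (s * x)\<close> over the interval from
  \<open>- c\<close> to \<open>c\<close>. It is affine in \<open>x\<close>, so under a conditional
  expectation only the conditional mean of \<open>x\<close> survives.\<close>

lemma exp_le_cosh_plus_sinh:
  fixes s c x :: real
  assumes "0 \<le> s" "0 < c" "\<bar>x\<bar> \<le> c"
  shows "exp (s * x) \<le> cosh (s * c) + x * (sinh (s * c) / c)"
proof -
  define u where "u = (x + c) / (2 * c)"
  have u: "0 \<le> u" "u \<le> 1" using assms by (auto simp: u_def field_simps)
  have x: "x = (1 - u) *\<^sub>R (- c) + u *\<^sub>R c" using assms by (simp add: u_def field_simps)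
  have "exp (s * x) \<le> (1 - u) * exp (s * - c) + u * exp (s * c)"
    by (subst x, rule convex_onD[OF convex_on_exp[OF assms(1)]]) (use u in auto)
  also have "\<dots> = cosh (s * c) + x * (sinh (s * c) / c)"
    using assms by (simp add: u_def cosh_def sinh_def field_simps)
  finally show ?thesis .
qed

context prob_space
begin

lemma sigma_finite_subalgebraI: "subalgebra M F \<Longrightarrow> sigma_finite_subalgebra M F"
  by (intro finite_measure_subalgebra_is_sigma_finite finite_measure_subalgebra.intro
      finite_measure_subalgebra_axioms.intro finite_measure_axioms)

text \<open>Replacing the exponential of the next increment by its chord reduces each step to the
  orthogonality of that increment to the past, and leaves the factor \<open>cosh (s * c)\<close>.
  All hypotheses stop at \<open>n\<close> because batches are known to be measurable only up to the
  horizon.\<close>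

lemma martingale_difference_mgf:
  fixes F :: "nat \<Rightarrow> 'a measure" and X :: "nat \<Rightarrow> 'a \<Rightarrow> real"
  assumes sub: "\<And>t. t \<le> n \<Longrightarrow> subalgebra M (F t)"
    and mono: "\<And>s t. s \<le> t \<Longrightarrow> t \<le> n \<Longrightarrow> subalgebra (F t) (F s)"
    and meas: "\<And>t. t \<in> {1..n} \<Longrightarrow> X t \<in> borel_measurable (F t)"
    and bound: "\<And>t. t \<in> {1..n} \<Longrightarrow> AE \<omega> in M. \<bar>X t \<omega>\<bar> \<le> c"
    and zero: "\<And>t. t \<in> {1..n} \<Longrightarrow> AE \<omega> in M. real_cond_exp M (F (t - 1)) (X t) \<omega> = 0"
    and c: "0 < c" and s: "0 \<le> s"
    and k: "k \<le> n"
  shows "integrable M (\<lambda>\<omega>. exp (s * (\<Sum>t=1..k. X t \<omega>)))"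
    and "expectation (\<lambda>\<omega>. exp (s * (\<Sum>t=1..k. X t \<omega>))) \<le> exp ((s * c)\<^sup>2 / 2) ^ k"
proof -
  define S where "S j \<omega> = (\<Sum>t=1..j. X t \<omega>)" for j \<omega>
  have S_F: "S j \<in> borel_measurable (F j)" if "j \<le> n" for j
    unfolding S_def using that
    by (intro borel_measurable_sum measurable_from_subalg[OF mono meas]) auto
  have S_M: "S j \<in> borel_measurable M" if "j \<le> n" for j
    using measurable_from_subalg[OF sub S_F] that by blast
  have X_M: "X t \<in> borel_measurable M" if "t \<in> {1..n}" for t
    using measurable_from_subalg[OF sub meas] that by auto
  have AE_c: "AE \<omega> in M. \<forall>t\<in>{1..n}. \<bar>X t \<omega>\<bar> \<le> c"
    using bound by (intro AE_finite_allI) auto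
  have S_bound: "AE \<omega> in M. exp (s * S j \<omega>) \<le> exp (s * (real j * c))" if "j \<le> n" for j
    using AE_c
  proof eventually_elim
    case (elim \<omega>)
    have "S j \<omega> \<le> (\<Sum>t=1..j. c)"
      unfolding S_def using that by (intro sum_mono) (metis abs_le_D1 atLeastAtMost_iff elim order_trans)
    then show ?case using s by (simp add: mult_left_mono)
  qed
  have int: "integrable M (\<lambda>\<omega>. exp (s * S j \<omega>))" if "j \<le> n" for j
    by (rule integrable_const_bound[where B = "exp (s * (real j * c))"])
      (use S_bound[OF that] S_M[OF that] in auto)
  show "integrable M (\<lambda>\<omega>. exp (s * (\<Sum>t=1..k. X t \<omega>)))"
    using int[OF k] by (simp add: S_def)
  have "expectation (\<lambda>\<omega>. exp (s * S k \<omega>)) \<le> exp ((s * c)\<^sup>2 / 2) ^ k"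
    using k
  proof (induction k)
    case 0
    then show ?case by (simp add: S_def prob_space)
  next
    case (Suc k)
    then have kn: "k \<le> n" and Sk: "Suc k \<in> {1..n}" by auto
    interpret sigma_finite_subalgebra M "F k"
      using sigma_finite_subalgebraI[OF sub[OF kn]] .
    have intX: "integrable M (\<lambda>\<omega>. exp (s * S k \<omega>) * X (Suc k) \<omega>)"
    proof (rule Bochner_Integration.integrable_bound)
      show "integrable M (\<lambda>\<omega>. exp (s * S k \<omega>) * c)"
        using int[OF kn] by simp
      show "AE \<omega> in M. norm (exp (s * S k \<omega>) * X (Suc k) \<omega>) \<le> norm (exp (s * S k \<omega>) * c)"
        using bound[OF Sk] by eventually_elim (simp add: abs_mult mult_left_mono)
    qed (use S_M[OF kn] X_M[OF Sk] in measurable)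
    \<comment> \<open>\<open>exp (s * S k)\<close> is measurable for \<open>F k\<close>, so the next
      increment may be replaced by its conditional mean given \<open>F k\<close>, which is
      0.\<close>
    have "expectation (\<lambda>\<omega>. exp (s * S k \<omega>) * X (Suc k) \<omega>)
        = expectation (\<lambda>\<omega>. exp (s * S k \<omega>) * real_cond_exp M (F k) (X (Suc k)) \<omega>)"
      by (rule real_cond_exp_intg(2)[symmetric, OF intX _ X_M[OF Sk]])
        (use S_F[OF kn] in measurable)
    also have "\<dots> = expectation (\<lambda>_. 0)"
      using zero[OF Sk] S_M[OF kn] by (intro integral_cong_AE) auto
    finally have orth: "expectation (\<lambda>\<omega>. exp (s * S k \<omega>) * X (Suc k) \<omega>) = 0" by simp
    have "expectation (\<lambda>\<omega>. exp (s * S (Suc k) \<omega>))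
        \<le> expectation (\<lambda>\<omega>. exp (s * S k \<omega>) * cosh (s * c) + exp (s * S k \<omega>) * X (Suc k) \<omega> * (sinh (s * c) / c))"
    proof (rule integral_mono_AE)
      show "AE \<omega> in M. exp (s * S (Suc k) \<omega>)
          \<le> exp (s * S k \<omega>) * cosh (s * c) + exp (s * S k \<omega>) * X (Suc k) \<omega> * (sinh (s * c) / c)"
        using bound[OF Sk]
      proof eventually_elim
        case (elim \<omega>)
        have "exp (s * S (Suc k) \<omega>) = exp (s * S k \<omega>) * exp (s * X (Suc k) \<omega>)"
          by (simp add: S_def distrib_left exp_add)
        also have "\<dots> \<le> exp (s * S k \<omega>) * (cosh (s * c) + X (Suc k) \<omega> * (sinh (s * c) / c))"
          by (intro mult_left_mono exp_le_cosh_plus_sinh s c elim) auto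
        finally show ?case by (simp add: algebra_simps)
      qed
    qed (use int[OF Suc.prems] int[OF kn] intX in auto)
    also have "\<dots> = expectation (\<lambda>\<omega>. exp (s * S k \<omega>)) * cosh (s * c)"
      using int[OF kn] intX orth by simp
    also have "\<dots> \<le> exp ((s * c)\<^sup>2 / 2) ^ k * exp ((s * c)\<^sup>2 / 2)"
      by (intro mult_mono Suc.IH kn cosh_real_le_exp) auto
    finally show ?case by (simp add: mult.commute)
  qed
  then show "expectation (\<lambda>\<omega>. exp (s * (\<Sum>t=1..k. X t \<omega>))) \<le> exp ((s * c)\<^sup>2 / 2) ^ k"
    by (simp add: S_def)
qed

theorem azuma_hoeffding:
  fixes F :: "nat \<Rightarrow> 'a measure" and X :: "nat \<Rightarrow> 'a \<Rightarrow> real"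
  assumes n: "1 \<le> n"
    and sub: "\<And>t. t \<le> n \<Longrightarrow> subalgebra M (F t)"
    and mono: "\<And>s t. s \<le> t \<Longrightarrow> t \<le> n \<Longrightarrow> subalgebra (F t) (F s)"
    and meas: "\<And>t. t \<in> {1..n} \<Longrightarrow> X t \<in> borel_measurable (F t)"
    and bound: "\<And>t. t \<in> {1..n} \<Longrightarrow> AE \<omega> in M. \<bar>X t \<omega>\<bar> \<le> c"
    and zero: "\<And>t. t \<in> {1..n} \<Longrightarrow> AE \<omega> in M. real_cond_exp M (F (t - 1)) (X t) \<omega> = 0"
    and c: "0 < c" and \<epsilon>: "0 < \<epsilon>"
  shows "prob {\<omega> \<in> space M. \<epsilon> \<le> (\<Sum>t=1..n. X t \<omega>)} \<le> exp (- \<epsilon>\<^sup>2 / (2 * real n * c\<^sup>2))"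
proof -
  \<comment> \<open>The minimiser of the Chernoff exponent
    \<open>- s * \<epsilon> + n * (s * c)^2 / 2\<close>.\<close>
  define s where "s = \<epsilon> / (real n * c\<^sup>2)"
  have s: "0 < s" using n c \<epsilon> by (simp add: s_def)
  note mgf = martingale_difference_mgf[where F = F and X = X and n = n and c = c and s = s and k = n]
  have "prob {\<omega> \<in> space M. \<epsilon> \<le> (\<Sum>t=1..n. X t \<omega>)}
      \<le> exp (- s * \<epsilon>) * expectation (\<lambda>\<omega>. exp (s * (\<Sum>t=1..n. X t \<omega>)))"
  proof -
    have int: "integrable M (\<lambda>\<omega>. exp (s * (\<Sum>t=1..n. X t \<omega>)))"
      using mgf(1)[OF sub mono meas bound zero c] s by simp
    then have "set_integrable M (space M) (\<lambda>\<omega>. exp (s * (\<Sum>t=1..n. X t \<omega>)))"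
      unfolding set_integrable_def by (rule integrable_mult_indicator[OF sets.top])
    from Chernoff_ineq_ge[OF s this sets.top, of \<epsilon>] show ?thesis
      unfolding set_integral_space[OF int] .
  qed
  also have "\<dots> \<le> exp (- s * \<epsilon>) * exp ((s * c)\<^sup>2 / 2) ^ n"
    using mgf(2)[OF sub mono meas bound zero c] s by (intro mult_left_mono) auto
  also have "\<dots> = exp (- s * \<epsilon> + real n * ((s * c)\<^sup>2 / 2))"
    unfolding exp_add exp_of_nat_mult ..
  also have "- s * \<epsilon> + real n * ((s * c)\<^sup>2 / 2) = - \<epsilon>\<^sup>2 / (2 * real n * c\<^sup>2)"
    using n c by (simp add: s_def power2_eq_square field_simps)
  finally show ?thesis .
qed

end

section \<open>Stochastic projected gradient descent\<close>

lemma infnorm_le_iff_cart: "infnorm (x :: real ^ 'n) \<le> b \<longleftrightarrow> (\<forall>j. \<bar>x $ j\<bar> \<le> b)"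
proof
  show "\<forall>j. \<bar>x $ j\<bar> \<le> b" if "infnorm x \<le> b"
    using component_le_infnorm_cart[of x] that order_trans by blast
  show "infnorm x \<le> b" if "\<forall>j. \<bar>x $ j\<bar> \<le> b"
    unfolding infnorm_cart using that by (intro cSup_least) auto
qed

lemma norm_square_le_infnorm_cart:
  fixes x :: "real ^ 'n"
  assumes "infnorm x \<le> b"
  shows "(norm x)\<^sup>2 \<le> real CARD('n) * b\<^sup>2"
proof -
  have "(norm x)\<^sup>2 \<le> (sqrt (real DIM(real ^ 'n)) * infnorm x)\<^sup>2"
    by (intro power_mono norm_le_infnorm) auto
  also have "\<dots> \<le> real CARD('n) * b\<^sup>2"
    using assms infnorm_pos_le[of x] by (simp add: power_mult_distrib power_mono)
  finally show ?thesis .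
qed

lemma borel_measurable_cart_iff:
  fixes f :: "'a \<Rightarrow> real ^ 'n"
  shows "f \<in> borel_measurable M \<longleftrightarrow> (\<forall>j. (\<lambda>\<omega>. f \<omega> $ j) \<in> borel_measurable M)"
  unfolding borel_measurable_euclidean_space[of f] by (auto simp: Basis_vec_def inner_axis)

text \<open>The projection is nonexpansive and fixes \<open>u\<close>, so expanding the square of
  one step bounds \<open>g t \<bullet> (x t - u)\<close>, and the squared distances to
  \<open>u\<close> telescope. The vectors \<open>g t\<close> are arbitrary: the lemma serves both
  for stochastic gradients and for the noise that drives the ghost sequence.\<close>

lemma projected_gradient_regret:
  fixes x g :: "nat \<Rightarrow> 'a::euclidean_space"
  assumes S: "convex S" "closed S" and u: "u \<in> S" and \<eta>: "0 < \<eta>"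
    and upd: "\<And>t. t \<in> {1..n} \<Longrightarrow> x (Suc t) = closest_point S (x t - \<eta> *\<^sub>R g t)"
  shows "(\<Sum>t=1..n. g t \<bullet> (x t - u)) \<le> (norm (x 1 - u))\<^sup>2 / (2 * \<eta>) + \<eta> / 2 * (\<Sum>t=1..n. (norm (g t))\<^sup>2)"
proof -
  have step: "g t \<bullet> (x t - u) \<le> ((norm (x t - u))\<^sup>2 - (norm (x (Suc t) - u))\<^sup>2) / (2 * \<eta>) + \<eta> / 2 * (norm (g t))\<^sup>2"
    if "t \<in> {1..n}" for t
  proof -
    have "dist (x (Suc t)) u \<le> dist (x t - \<eta> *\<^sub>R g t) u"
      using closest_point_lipschitz[OF S, of "x t - \<eta> *\<^sub>R g t" u] u
      by (auto simp: upd[OF that] closest_point_self)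
    then have "(norm (x (Suc t) - u))\<^sup>2 \<le> (norm ((x t - u) - \<eta> *\<^sub>R g t))\<^sup>2"
      by (intro power_mono) (auto simp: dist_norm algebra_simps)
    also have "\<dots> = (norm (x t - u))\<^sup>2 - 2 * \<eta> * (g t \<bullet> (x t - u)) + \<eta>\<^sup>2 * (norm (g t))\<^sup>2"
      unfolding power2_norm_eq_inner by (simp add: inner_diff inner_commute algebra_simps power2_eq_square)
    finally show ?thesis using \<eta> by (simp add: field_simps power2_eq_square)
  qed
  have "(\<Sum>t=1..n. g t \<bullet> (x t - u))
      \<le> (\<Sum>t=1..n. ((norm (x t - u))\<^sup>2 - (norm (x (Suc t) - u))\<^sup>2) / (2 * \<eta>) + \<eta> / 2 * (norm (g t))\<^sup>2)"
    by (intro sum_mono step)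
  also have "\<dots> = (\<Sum>t=1..n. (norm (x t - u))\<^sup>2 - (norm (x (Suc t) - u))\<^sup>2) / (2 * \<eta>) + \<eta> / 2 * (\<Sum>t=1..n. (norm (g t))\<^sup>2)"
    by (simp add: sum.distrib sum_divide_distrib sum_distrib_left)
  also have "(\<Sum>t=1..n. (norm (x t - u))\<^sup>2 - (norm (x (Suc t) - u))\<^sup>2) = (norm (x 1 - u))\<^sup>2 - (norm (x (Suc n) - u))\<^sup>2"
    by (induction n) simp_all
  also have "((norm (x 1 - u))\<^sup>2 - (norm (x (Suc n) - u))\<^sup>2) / (2 * \<eta>) \<le> (norm (x 1 - u))\<^sup>2 / (2 * \<eta>)"
    using \<eta> by (intro divide_right_mono) auto
  finally show ?thesis by simp
qed

text \<open>Projection onto a nonempty closed convex set is continuous, hence Borel. The index shift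
  is the point: iterate \<open>Suc k\<close> uses only rounds up to \<open>k\<close>, so the process
  is predictable and not merely adapted. The identities are assumed on \<Omega> only, so
  measurability is transferred by congruence on the space.\<close>

lemma projected_gradient_adapted:
  fixes x g :: "nat \<Rightarrow> 'w \<Rightarrow> 'a::euclidean_space" and F :: "nat \<Rightarrow> 'w measure"
  assumes S: "convex S" "closed S" and x1: "x1 \<in> S"
    and sp: "\<And>t. t \<le> n \<Longrightarrow> space (F t) = \<Omega>"
    and mono: "\<And>s t. s \<le> t \<Longrightarrow> t \<le> n \<Longrightarrow> subalgebra (F t) (F s)"
    and init: "\<And>\<omega>. \<omega> \<in> \<Omega> \<Longrightarrow> x 1 \<omega> = x1"
    and meas: "\<And>t. t \<in> {1..n} \<Longrightarrow> g t \<in> borel_measurable (F t)"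
    and upd: "\<And>t \<omega>. t \<in> {1..n} \<Longrightarrow> \<omega> \<in> \<Omega> \<Longrightarrow> x (Suc t) \<omega> = closest_point S (x t \<omega> - \<eta> *\<^sub>R g t \<omega>)"
    and k: "k \<le> n"
  shows "x (Suc k) \<in> borel_measurable (F k)" and "\<omega> \<in> \<Omega> \<Longrightarrow> x (Suc k) \<omega> \<in> S"
proof -
  have "x (Suc k) \<in> borel_measurable (F k) \<and> (\<forall>\<omega>\<in>\<Omega>. x (Suc k) \<omega> \<in> S)"
    using k
  proof (induction k)
    case 0
    have "x 1 \<in> borel_measurable (F 0) \<longleftrightarrow> (\<lambda>_. x1) \<in> borel_measurable (F 0)"
      by (rule measurable_cong) (simp add: sp init del: One_nat_def)
    then show ?case using x1 init by simp
  next
    case (Suc k)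
    have [measurable]: "x (Suc k) \<in> borel_measurable (F (Suc k))"
      using Suc by (intro measurable_from_subalg[OF mono[of k "Suc k"]]) auto
    have [measurable]: "g (Suc k) \<in> borel_measurable (F (Suc k))"
      using Suc by (intro meas) auto
    have "x (Suc (Suc k)) \<in> borel_measurable (F (Suc k)) \<longleftrightarrow>
        (\<lambda>\<omega>. closest_point S (x (Suc k) \<omega> - \<eta> *\<^sub>R g (Suc k) \<omega>)) \<in> borel_measurable (F (Suc k))"
      using Suc.prems by (intro measurable_cong) (auto simp: sp upd)
    moreover have "(\<lambda>\<omega>. closest_point S (x (Suc k) \<omega> - \<eta> *\<^sub>R g (Suc k) \<omega>)) \<in> borel_measurable (F (Suc k))"
      using x1 by (intro borel_measurable_continuous_on[OF continuous_on_closest_point[OF S]]) (auto, measurable)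
    moreover have "x (Suc (Suc k)) \<omega> \<in> S" if "\<omega> \<in> \<Omega>" for \<omega>
      using that x1 Suc.prems S by (subst upd) (auto intro!: closest_point_in_set)
    ultimately show ?case by blast
  qed
  then show "x (Suc k) \<in> borel_measurable (F k)" and "\<omega> \<in> \<Omega> \<Longrightarrow> x (Suc k) \<omega> \<in> S"
    by auto
qed

context prob_space
begin

text \<open>\<open>X\<close> is chosen before \<open>u\<close>, and \<open>u\<close> is quantified
  inside the almost-everywhere statement, so the comparator may differ from outcome to outcome. The
  bound \<open>c\<close> on the increments enters through \<open>noise\<close> because it depends on
  the shape of \<open>S\<close>, which is different for the two players.\<close>

lemma stochastic_projected_gradient_regret:
  fixes x g G :: "nat \<Rightarrow> 'a \<Rightarrow> real ^ 'n" and F :: "nat \<Rightarrow> 'a measure"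
  assumes S: "convex S" "closed S" and x1: "x1 \<in> S" and \<eta>: "0 < \<eta>"
    and sub: "\<And>t. t \<le> n \<Longrightarrow> subalgebra M (F t)"
    and mono: "\<And>s t. s \<le> t \<Longrightarrow> t \<le> n \<Longrightarrow> subalgebra (F t) (F s)"
    and init: "\<And>\<omega>. \<omega> \<in> space M \<Longrightarrow> x 1 \<omega> = x1"
    and meas: "\<And>t. t \<in> {1..n} \<Longrightarrow> g t \<in> borel_measurable (F t)"
    and upd: "\<And>t \<omega>. t \<in> {1..n} \<Longrightarrow> \<omega> \<in> space M \<Longrightarrow> x (Suc t) \<omega> = closest_point S (x t \<omega> - \<eta> *\<^sub>R g t \<omega>)"
    and g_bound: "\<And>t. t \<in> {1..n} \<Longrightarrow> AE \<omega> in M. infnorm (g t \<omega>) \<le> K"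
    and G_bound: "\<And>t \<omega>. t \<in> {1..n} \<Longrightarrow> \<omega> \<in> space M \<Longrightarrow> infnorm (G t \<omega>) \<le> K"
    and unbiased: "\<And>t j. t \<in> {1..n} \<Longrightarrow>
        AE \<omega> in M. real_cond_exp M (F (t - 1)) (\<lambda>\<omega>. g t \<omega> $ j) \<omega> = G t \<omega> $ j"
    and diam: "\<And>u. u \<in> S \<Longrightarrow> (norm (x1 - u))\<^sup>2 \<le> 2 * D"
    and noise: "\<And>v y z. infnorm v \<le> 2 * K \<Longrightarrow> y \<in> S \<Longrightarrow> z \<in> S \<Longrightarrow> \<bar>v \<bullet> (y - z)\<bar> \<le> c"
  shows "\<exists>X. (\<forall>t\<in>{1..n}. X t \<in> borel_measurable (F t) \<and> (AE \<omega> in M. \<bar>X t \<omega>\<bar> \<le> c) \<and>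
             (AE \<omega> in M. real_cond_exp M (F (t - 1)) (X t) \<omega> = 0)) \<and>
           (AE \<omega> in M. \<forall>u\<in>S. (\<Sum>t=1..n. G t \<omega> \<bullet> (x t \<omega> - u))
              \<le> 2 * D / \<eta> + 5 / 2 * \<eta> * real n * real CARD('n) * K\<^sup>2 + (\<Sum>t=1..n. X t \<omega>))"
proof -
  \<comment> \<open>\<open>G\<close> need not be measurable; \<open>H\<close> is a version of it adapted to the filtration.\<close>
  define H where "H t \<omega> = (\<chi> j. real_cond_exp M (F (t - 1)) (\<lambda>\<omega>. g t \<omega> $ j) \<omega>)" for t \<omega>
  \<comment> \<open>The ghost sequence; the index shift makes it start at round 1, like \<open>x\<close>.\<close>
  define y where "y t \<omega> = rec_nat x1 (\<lambda>k z. closest_point S (z - \<eta> *\<^sub>R (H (Suc k) \<omega> - g (Suc k) \<omega>))) (t - 1)"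
    for t \<omega>
  \<comment> \<open>Both \<open>x t\<close> and \<open>y t\<close> are determined by the rounds
    before \<open>t\<close>, so the centred noise of round \<open>t\<close> is paired with something
    already known. This makes \<open>X\<close> a martingale difference sequence.\<close>
  define X where "X t \<omega> = (H t \<omega> - g t \<omega>) \<bullet> (x t \<omega> - y t \<omega>)" for t \<omega>
  have y1: "y 1 \<omega> = x1" for \<omega> by (simp add: y_def)
  have y_upd: "y (Suc t) \<omega> = closest_point S (y t \<omega> - \<eta> *\<^sub>R (H t \<omega> - g t \<omega>))" if "t \<in> {1..n}" for t \<omega>
    using that by (cases t) (auto simp: y_def)
  have sp: "space (F t) = space M" if "t \<le> n" for t
    using sub[OF that] by (simp add: subalgebra_def)
  have H_meas: "H t \<in> borel_measurable (F (t - 1))" for t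
    unfolding borel_measurable_cart_iff by (simp add: H_def)
  have H_meas': "H t \<in> borel_measurable (F t)" if "t \<in> {1..n}" for t
    using that by (intro measurable_from_subalg[OF mono H_meas]) auto
  have HG: "AE \<omega> in M. H t \<omega> = G t \<omega>" if "t \<in> {1..n}" for t
  proof -
    have "AE \<omega> in M. \<forall>j\<in>UNIV. real_cond_exp M (F (t - 1)) (\<lambda>\<omega>. g t \<omega> $ j) \<omega> = G t \<omega> $ j"
      using unbiased[OF that] by (intro AE_finite_allI) auto
    then show ?thesis by eventually_elim (simp add: H_def vec_eq_iff)
  qed
  note xF = projected_gradient_adapted[OF S x1 sp mono init meas upd]
  note yF = projected_gradient_adapted[where x = y and g = "\<lambda>t \<omega>. H t \<omega> - g t \<omega>" and F = F and n = n,
      OF S x1 sp mono y1 borel_measurable_diff[OF H_meas' meas] y_upd]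
  have diff_meas: "(\<lambda>\<omega>. x t \<omega> - y t \<omega>) \<in> borel_measurable (F (t - 1))" if t: "t \<in> {1..n}" for t
  proof -
    obtain k where k: "t = Suc k" "k \<le> n" using t by (cases t) auto
    show ?thesis
      unfolding k diff_Suc_1 by (rule borel_measurable_diff[OF xF(1) yF(1)]) (use k in auto)
  qed
  have xy_S: "x t \<omega> \<in> S" "y t \<omega> \<in> S" if "t \<in> {1..n}" "\<omega> \<in> space M" for t \<omega>
    using xF(2)[where k = "t - 1" and \<omega> = \<omega>] yF(2)[where k = "t - 1" and \<omega> = \<omega>] that by auto
  have X_meas: "X t \<in> borel_measurable (F t)" if t: "t \<in> {1..n}" for t
    unfolding X_def using t
    by (intro borel_measurable_inner borel_measurable_diff[OF H_meas' meas] measurable_from_subalg[OF mono diff_meas]) auto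
  have dev: "AE \<omega> in M. infnorm (H t \<omega> - g t \<omega>) \<le> 2 * K" if t: "t \<in> {1..n}" for t
    using HG[OF t] g_bound[OF t] AE_space
  proof eventually_elim
    case (elim \<omega>)
    have "infnorm (G t \<omega> - g t \<omega>) \<le> infnorm (G t \<omega>) + infnorm (g t \<omega>)"
      using infnorm_triangle[of "G t \<omega>" "- g t \<omega>"] by (simp add: infnorm_neg)
    then show ?case using elim G_bound[OF t, of \<omega>] by simp
  qed
  have X_bound: "AE \<omega> in M. \<bar>X t \<omega>\<bar> \<le> c" if t: "t \<in> {1..n}" for t
    using dev[OF t] AE_space by eventually_elim (auto simp: X_def intro!: noise xy_S t)
  have X_zero: "AE \<omega> in M. real_cond_exp M (F (t - 1)) (X t) \<omega> = 0" if t: "t \<in> {1..n}" for t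
  proof -
    \<comment> \<open>Both points lie within \<open>sqrt (2 * D)\<close> of \<open>x1\<close>, so
      \<open>B\<close> bounds their distance. It serves only to make the coordinate products
      integrable.\<close>
    define B where "B = 2 * sqrt (2 * D)"
    have tn: "t - 1 \<le> n" using t by auto
    interpret sigma_finite_subalgebra M "F (t - 1)"
      using sigma_finite_subalgebraI[OF sub[OF tn]] .
    have g_M [measurable]: "g t \<in> borel_measurable M"
      using t measurable_from_subalg[OF sub meas] by auto
    have diff_F: "(\<lambda>\<omega>. (x t \<omega> - y t \<omega>) $ j) \<in> borel_measurable (F (t - 1))" for j
      using diff_meas[OF t] unfolding borel_measurable_cart_iff by blast
    have diff_M: "(\<lambda>\<omega>. (x t \<omega> - y t \<omega>) $ j) \<in> borel_measurable M" for j
      by (rule measurable_from_subalg[OF sub[OF tn] diff_F])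
    have g_j: "(\<lambda>\<omega>. g t \<omega> $ j) \<in> borel_measurable M" for j
      using g_M unfolding borel_measurable_cart_iff by blast
    have H_j: "(\<lambda>\<omega>. H t \<omega> $ j) \<in> borel_measurable (F (t - 1))" for j
      using H_meas unfolding borel_measurable_cart_iff by blast
    have int_g: "integrable M (\<lambda>\<omega>. g t \<omega> $ j)" for j
      by (rule integrable_const_bound[where B = K])
        (use g_bound[OF t] g_j in \<open>auto simp: infnorm_le_iff_cart elim: eventually_mono\<close>)
    have int_H: "integrable M (\<lambda>\<omega>. H t \<omega> $ j)" for j
      using real_cond_exp_int(1)[OF int_g] by (simp add: H_def)
    have norm_diff: "norm (x t \<omega> - y t \<omega>) \<le> B" if "\<omega> \<in> space M" for \<omega>
    proof -
      have "norm (x1 - u) \<le> sqrt (2 * D)" if "u \<in> S" for u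
        using diam[OF that] real_le_rsqrt by blast
      from this[OF xy_S(1)[OF t that]] this[OF xy_S(2)[OF t that]] show ?thesis
        using norm_triangle_ineq4[of "x1 - y t \<omega>" "x1 - x t \<omega>"] by (simp add: B_def)
    qed
    have int_prod: "integrable M (\<lambda>\<omega>. (x t \<omega> - y t \<omega>) $ j * (H t \<omega> $ j - g t \<omega> $ j))" for j
    proof (rule integrable_const_bound[where B = "B * (2 * K)"])
      show "AE \<omega> in M. norm ((x t \<omega> - y t \<omega>) $ j * (H t \<omega> $ j - g t \<omega> $ j)) \<le> B * (2 * K)"
        using dev[OF t] AE_space
      proof eventually_elim
        case (elim \<omega>)
        have "\<bar>(x t \<omega> - y t \<omega>) $ j\<bar> \<le> B"
          using component_le_norm_cart[of "x t \<omega> - y t \<omega>" j] norm_diff[OF elim(2)] by linarith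
        moreover have "\<bar>H t \<omega> $ j - g t \<omega> $ j\<bar> \<le> 2 * K"
          using elim(1) unfolding infnorm_le_iff_cart by simp
        ultimately show ?case unfolding real_norm_def abs_mult by (intro mult_mono) auto
      qed
    qed (intro borel_measurable_times borel_measurable_diff diff_M g_j borel_measurable_integrable[OF int_H])
    \<comment> \<open>Conditional expectations are taken coordinate by coordinate. The mean of
      \<open>H t - g t\<close> vanishes by the construction of \<open>H\<close>; unbiasedness enters
      through the almost sure equality of \<open>H\<close> and \<open>G\<close>.\<close>
    have zero: "AE \<omega> in M. real_cond_exp M (F (t - 1)) (\<lambda>\<omega>. (x t \<omega> - y t \<omega>) $ j * (H t \<omega> $ j - g t \<omega> $ j)) \<omega> = 0" for j
    proof -
      note real_cond_exp_mult[OF diff_F borel_measurable_diff[OF borel_measurable_integrable[OF int_H] g_j] int_prod, of j]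
      moreover note real_cond_exp_diff[OF int_H int_g, of j j]
      moreover note real_cond_exp_F_meas[OF int_H H_j, of j]
      ultimately show ?thesis by eventually_elim (simp add: H_def)
    qed
    have "AE \<omega> in M. \<forall>j\<in>UNIV. real_cond_exp M (F (t - 1)) (\<lambda>\<omega>. (x t \<omega> - y t \<omega>) $ j * (H t \<omega> $ j - g t \<omega> $ j)) \<omega> = 0"
      using zero by (intro AE_finite_allI) auto
    moreover have "X t = (\<lambda>\<omega>. \<Sum>j\<in>UNIV. (x t \<omega> - y t \<omega>) $ j * (H t \<omega> $ j - g t \<omega> $ j))"
      by (simp add: X_def fun_eq_iff inner_vec_def mult.commute)
    moreover note real_cond_exp_sum[of "\<lambda>j \<omega>. (x t \<omega> - y t \<omega>) $ j * (H t \<omega> $ j - g t \<omega> $ j)" UNIV, OF int_prod]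
    ultimately show ?thesis by (auto elim: eventually_elim2)
  qed
  \<comment> \<open>One null set is fixed for all rounds; outside it the argument is deterministic
    and therefore covers every \<open>u\<close> at once.\<close>
  have "AE \<omega> in M. \<forall>t\<in>{1..n}. H t \<omega> = G t \<omega> \<and> infnorm (g t \<omega>) \<le> K \<and> infnorm (H t \<omega> - g t \<omega>) \<le> 2 * K"
    using HG g_bound dev by (intro AE_finite_allI) auto
  then have "AE \<omega> in M. \<forall>u\<in>S. (\<Sum>t=1..n. G t \<omega> \<bullet> (x t \<omega> - u))
           \<le> 2 * D / \<eta> + 5 / 2 * \<eta> * real n * real CARD('n) * K\<^sup>2 + (\<Sum>t=1..n. X t \<omega>)"
    using AE_space
  proof eventually_elim
    case (elim \<omega>)
    show ?case
    proof
      fix u assume u: "u \<in> S"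
      have g2: "(\<Sum>t=1..n. (norm (g t \<omega>))\<^sup>2) \<le> (\<Sum>t=1..n. real CARD('n) * K\<^sup>2)"
        using elim by (intro sum_mono norm_square_le_infnorm_cart) auto
      have h2: "(\<Sum>t=1..n. (norm (H t \<omega> - g t \<omega>))\<^sup>2) \<le> (\<Sum>t=1..n. real CARD('n) * (2 * K)\<^sup>2)"
        using elim by (intro sum_mono norm_square_le_infnorm_cart) blast
      have D: "(norm (x1 - u))\<^sup>2 / (2 * \<eta>) \<le> D / \<eta>"
        using diam[OF u] \<eta> by (simp add: field_simps)
      have "(\<Sum>t=1..n. g t \<omega> \<bullet> (x t \<omega> - u)) \<le> (norm (x 1 \<omega> - u))\<^sup>2 / (2 * \<eta>) + \<eta> / 2 * (\<Sum>t=1..n. (norm (g t \<omega>))\<^sup>2)"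
        by (rule projected_gradient_regret[OF S u \<eta>]) (use upd elim in auto)
      also have "\<dots> \<le> D / \<eta> + \<eta> / 2 * (\<Sum>t=1..n. real CARD('n) * K\<^sup>2)"
        using D g2 \<eta> init elim by (intro add_mono mult_left_mono) auto
      finally have 1: "(\<Sum>t=1..n. g t \<omega> \<bullet> (x t \<omega> - u)) \<le> D / \<eta> + \<eta> / 2 * (\<Sum>t=1..n. real CARD('n) * K\<^sup>2)" .
      have "(\<Sum>t=1..n. (H t \<omega> - g t \<omega>) \<bullet> (y t \<omega> - u)) \<le> (norm (y 1 \<omega> - u))\<^sup>2 / (2 * \<eta>) + \<eta> / 2 * (\<Sum>t=1..n. (norm (H t \<omega> - g t \<omega>))\<^sup>2)"
        by (rule projected_gradient_regret[OF S u \<eta>]) (use y_upd in auto)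
      also have "\<dots> \<le> D / \<eta> + \<eta> / 2 * (\<Sum>t=1..n. real CARD('n) * (2 * K)\<^sup>2)"
        unfolding y1 using D h2 \<eta> by (intro add_mono mult_left_mono) auto
      finally have 2: "(\<Sum>t=1..n. (H t \<omega> - g t \<omega>) \<bullet> (y t \<omega> - u)) \<le> D / \<eta> + \<eta> / 2 * (\<Sum>t=1..n. real CARD('n) * (2 * K)\<^sup>2)" .
      have "(\<Sum>t=1..n. G t \<omega> \<bullet> (x t \<omega> - u)) = (\<Sum>t=1..n. H t \<omega> \<bullet> (x t \<omega> - u))"
        using elim by (intro sum.cong) auto
      \<comment> \<open>Write \<open>H = g + (H - g)\<close> and split
        \<open>x - u = (y - u) + (x - y)\<close> in the noise term. The comparator is left only in
        two deterministic regrets, of the player against \<open>g\<close> and of the ghost against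
        \<open>H - g\<close>.\<close>
      also have "\<dots> = (\<Sum>t=1..n. g t \<omega> \<bullet> (x t \<omega> - u) + (H t \<omega> - g t \<omega>) \<bullet> (y t \<omega> - u) + X t \<omega>)"
        by (intro sum.cong) (auto simp: X_def inner_diff algebra_simps)
      also have "\<dots> = (\<Sum>t=1..n. g t \<omega> \<bullet> (x t \<omega> - u)) + (\<Sum>t=1..n. (H t \<omega> - g t \<omega>) \<bullet> (y t \<omega> - u)) + (\<Sum>t=1..n. X t \<omega>)"
        by (simp add: sum.distrib)
      finally show "(\<Sum>t=1..n. G t \<omega> \<bullet> (x t \<omega> - u))
           \<le> 2 * D / \<eta> + 5 / 2 * \<eta> * real n * real CARD('n) * K\<^sup>2 + (\<Sum>t=1..n. X t \<omega>)"
        using 1 2 by (simp add: algebra_simps power2_eq_square)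
    qed
  qed
  with X_meas X_bound X_zero show ?thesis by blast
qed

end

section \<open>Gradients, norms and the simplex\<close>

lemma GDERIV_unique: "GDERIV \<phi> x :> D \<Longrightarrow> GDERIV \<phi> x :> E \<Longrightarrow> D = E"
  unfolding gderiv_def
  by (drule (1) has_derivative_unique) (metis inner_commute vector_eq_rdot)

lemma gradientI: "GDERIV \<phi> x :> D \<Longrightarrow> gradient \<phi> x = D"
  unfolding gradient_def by (rule the_equality) (auto dest: GDERIV_unique)

text \<open>Riesz representation: the values of the derivative on the basis are the coordinates of
  the gradient. Thus the definite description in \<open>gradient\<close> denotes at points of
  differentiability.\<close>

lemma GDERIV_gradient:
  fixes \<phi> :: "'a::euclidean_space \<Rightarrow> real"
  assumes "\<phi> differentiable (at x)"
  shows "GDERIV \<phi> x :> gradient \<phi> x"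
proof -
  obtain \<phi>' where \<phi>': "(\<phi> has_derivative \<phi>') (at x)"
    using assms by (auto simp: differentiable_def)
  interpret bounded_linear \<phi>' by (rule has_derivative_bounded_linear[OF \<phi>'])
  have "\<phi>' = (\<lambda>h. h \<bullet> (\<Sum>b\<in>Basis. \<phi>' b *\<^sub>R b))"
  proof
    fix h
    have "\<phi>' h = \<phi>' (\<Sum>b\<in>Basis. (h \<bullet> b) *\<^sub>R b)" by (simp add: euclidean_representation)
    also have "\<dots> = h \<bullet> (\<Sum>b\<in>Basis. \<phi>' b *\<^sub>R b)"
      by (simp add: sum scaleR inner_sum_right mult.commute)
    finally show "\<phi>' h = h \<bullet> (\<Sum>b\<in>Basis. \<phi>' b *\<^sub>R b)" .
  qed
  then have "GDERIV \<phi> x :> (\<Sum>b\<in>Basis. \<phi>' b *\<^sub>R b)"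
    using \<phi>' by (simp add: gderiv_def)
  then show ?thesis using gradientI by metis
qed

text \<open>By convexity the difference quotients along the segment from \<open>x\<close> to
  \<open>y\<close> are at most \<open>\<phi> y - \<phi> x\<close>; let the step tend to 0. The limit
  is one-sided because \<open>x\<close> may be a boundary point of \<open>S\<close>, beyond which
  convexity says nothing.\<close>

lemma convex_on_ge_gradient:
  fixes \<phi> :: "'a::euclidean_space \<Rightarrow> real"
  assumes conv: "convex_on S \<phi>" and diff: "\<phi> differentiable (at x)" and "x \<in> S" "y \<in> S"
  shows "\<phi> x + gradient \<phi> x \<bullet> (y - x) \<le> \<phi> y"
proof -
  have "((\<lambda>h. \<phi> (x + h *\<^sub>R (y - x))) has_derivative (\<lambda>h. (h *\<^sub>R (y - x)) \<bullet> gradient \<phi> x)) (at 0)"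
    by (rule has_derivative_compose[of "\<lambda>h. x + h *\<^sub>R (y - x)" _ _ _ \<phi>])
      (use GDERIV_gradient[OF diff] in \<open>auto simp: gderiv_def intro!: derivative_eq_intros\<close>)
  then have "((\<lambda>h. \<phi> (x + h *\<^sub>R (y - x))) has_real_derivative gradient \<phi> x \<bullet> (y - x)) (at 0)"
    by (simp add: has_field_derivative_def inner_commute mult.commute[of _ "_ \<bullet> _"])
  then have "((\<lambda>h. (\<phi> (x + h *\<^sub>R (y - x)) - \<phi> x) / h) \<longlongrightarrow> gradient \<phi> x \<bullet> (y - x)) (at_right 0)"
    using filterlim_at_split by (auto simp: DERIV_def)
  moreover have "\<forall>\<^sub>F h in at_right 0. (\<phi> (x + h *\<^sub>R (y - x)) - \<phi> x) / h \<le> \<phi> y - \<phi> x"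
    unfolding eventually_at_right_field
  proof (intro exI[of _ 1] conjI allI impI)
    fix h :: real assume h: "0 < h" "h < 1"
    have "\<phi> (x + h *\<^sub>R (y - x)) = \<phi> ((1 - h) *\<^sub>R x + h *\<^sub>R y)" by (simp add: algebra_simps)
    also have "\<dots> \<le> (1 - h) * \<phi> x + h * \<phi> y"
      using h assms by (intro convex_onD[OF conv]) auto
    finally show "(\<phi> (x + h *\<^sub>R (y - x)) - \<phi> x) / h \<le> \<phi> y - \<phi> x"
      using h by (simp add: field_simps)
  qed simp
  ultimately have "gradient \<phi> x \<bullet> (y - x) \<le> \<phi> y - \<phi> x"
    by (intro tendsto_upperbound) auto
  then show ?thesis by simp
qed

text \<open>Cauchy-Schwarz, with the supremum attained at \<open>sgn y\<close>; for
  \<open>y = 0\<close> this is the zero vector, still in the unit ball.\<close>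

lemma dual_norm_norm: "dual_norm norm (y :: 'a::real_inner) = norm y"
  unfolding dual_norm_def
proof (rule cSup_eq_maximum)
  have "sgn y \<bullet> y = norm y"
    by (cases "y = 0") (simp_all add: sgn_div_norm dot_square_norm power2_eq_square)
  then show "norm y \<in> (\<lambda>x. x \<bullet> y) ` {x. norm x \<le> 1}"
    by (intro image_eqI[of _ _ "sgn y"]) (auto simp: norm_sgn)
  fix z assume "z \<in> (\<lambda>x. x \<bullet> y) ` {x. norm x \<le> 1}"
  then obtain x where x: "z = x \<bullet> y" "norm x \<le> 1" by auto
  have "x \<bullet> y \<le> norm x * norm y" by (rule norm_cauchy_schwarz)
  also have "\<dots> \<le> 1 * norm y" using x by (intro mult_right_mono) auto
  finally show "z \<le> norm y" using x by simp
qed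

lemma GDERIV_half_norm_square: "GDERIV (\<lambda>x::'a::real_inner. 1 / 2 * (norm x)\<^sup>2) x :> x"
  unfolding gderiv_def power2_norm_eq_inner
  by (auto intro!: derivative_eq_intros simp: inner_commute)

text \<open>For the squared Euclidean norm the defining inequality is an identity.\<close>

lemma strongly_convex_half_norm_square:
  "strongly_convex (\<lambda>x::'a::real_inner. 1 / 2 * (norm x)\<^sup>2) norm 1"
  unfolding strongly_convex_def power2_norm_eq_inner
  by (auto simp: inner_add inner_diff inner_commute algebra_simps add_divide_distrib diff_divide_distrib)

lemma bregman_half_norm_square:
  "bregman (\<lambda>x::'a::real_inner. 1 / 2 * (norm x)\<^sup>2) x y = 1 / 2 * (norm (x - y))\<^sup>2"
  unfolding bregman_def gradientI[OF GDERIV_half_norm_square]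
  unfolding power2_norm_eq_inner
  by (simp add: inner_diff inner_commute algebra_simps)

lemma simplex_set_component_le_1: "(\<alpha> :: real ^ 'm::finite) \<in> simplex_set \<Longrightarrow> \<alpha> $ i \<le> 1"
  using member_le_sum[of i UNIV "\<lambda>i. \<alpha> $ i"] by (auto simp: simplex_set_def)

lemma closed_simplex_set: "closed (simplex_set :: (real ^ 'm::finite) set)"
  unfolding simplex_set_def
  by (intro closed_Collect_conj closed_Collect_all closed_Collect_eq closed_Collect_le continuous_intros)

lemma convex_simplex_set: "convex (simplex_set :: (real ^ 'm::finite) set)"
  unfolding convex_def simplex_set_def
  by (auto simp: sum.distrib simp flip: sum_distrib_left)

lemma axis_mem_simplex_set: "axis i 1 \<in> (simplex_set :: (real ^ 'm::finite) set)"
  by (auto simp: simplex_set_def axis_def)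

lemma uniform_mem_simplex_set: "(\<chi> i. 1 / real CARD('m)) \<in> (simplex_set :: (real ^ 'm::finite) set)"
  by (simp add: simplex_set_def)

text \<open>The l1 diameter of the simplex, free of the dimension; it controls the noise of the
  weight player.\<close>

lemma sum_abs_diff_simplex_le:
  fixes \<alpha> \<beta> :: "real ^ 'm::finite"
  assumes "\<alpha> \<in> simplex_set" "\<beta> \<in> simplex_set"
  shows "(\<Sum>i\<in>UNIV. \<bar>(\<alpha> - \<beta>) $ i\<bar>) \<le> 2"
proof -
  have "(\<Sum>i\<in>UNIV. \<bar>(\<alpha> - \<beta>) $ i\<bar>) \<le> (\<Sum>i\<in>UNIV. \<alpha> $ i + \<beta> $ i)"
    using assms by (intro sum_mono) (auto simp: simplex_set_def abs_le_iff add_increasing add_increasing2)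
  also have "\<dots> = 2" using assms by (simp add: simplex_set_def sum.distrib)
  finally show ?thesis .
qed

text \<open>The Euclidean norm is at most the l1 norm. Half of the resulting 4 is the constant
  \<open>D_lam = 2\<close>.\<close>

lemma norm_diff_simplex_le:
  fixes \<alpha> \<beta> :: "real ^ 'm::finite"
  assumes "\<alpha> \<in> simplex_set" "\<beta> \<in> simplex_set"
  shows "(norm (\<alpha> - \<beta>))\<^sup>2 \<le> 4"
  using power_mono[OF order_trans[OF norm_le_l1_cart sum_abs_diff_simplex_le[OF assms]], of 2] by simp

text \<open>Hoelder's inequality for the sup norm and the l1 norm.\<close>

lemma abs_inner_le_infnorm_l1:
  fixes v z :: "real ^ 'n"
  assumes "infnorm v \<le> b"
  shows "\<bar>v \<bullet> z\<bar> \<le> b * (\<Sum>i\<in>UNIV. \<bar>z $ i\<bar>)"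
proof -
  have "\<bar>v \<bullet> z\<bar> \<le> (\<Sum>i\<in>UNIV. \<bar>v $ i * z $ i\<bar>)"
    unfolding inner_vec_def inner_real_def by (rule sum_abs)
  also have "\<dots> \<le> (\<Sum>i\<in>UNIV. b * \<bar>z $ i\<bar>)"
    using assms by (intro sum_mono) (auto simp: infnorm_le_iff_cart abs_mult intro!: mult_right_mono)
  finally show ?thesis by (simp add: sum_distrib_left)
qed

lemma lagrangian_le_TCH:
  assumes "\<alpha> \<in> simplex_set"
  shows "lagrangian f w x \<alpha> \<le> TCH f w x"
proof -
  have "lagrangian f w x \<alpha> \<le> (\<Sum>i\<in>UNIV. \<alpha> $ i * TCH f w x)"
    unfolding lagrangian_def TCH_def mult.assoc using assms
    by (intro sum_mono mult_left_mono Max_ge) (auto simp: simplex_set_def)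
  also have "\<dots> = TCH f w x" using assms by (simp add: simplex_set_def flip: sum_distrib_right)
  finally show ?thesis .
qed

lemma TCH_attained:
  obtains i where "TCH f w x = w $ i * f i x"
proof -
  have "TCH f w x \<in> range (\<lambda>i. w $ i * f i x)" unfolding TCH_def by (rule Max_in) auto
  then show ?thesis using that by auto
qed

lemma GDERIV_lagrangian_theta:
  fixes f :: "'m::finite \<Rightarrow> 'a::real_inner \<Rightarrow> real"
  assumes "\<And>i. GDERIV (f i) x :> D i"
  shows "GDERIV (\<lambda>x. lagrangian f w x \<alpha>) x :> (\<Sum>i\<in>UNIV. (\<alpha> $ i * w $ i) *\<^sub>R D i)"
  using assms unfolding gderiv_def lagrangian_def inner_sum_right inner_scaleR_right
  by (intro has_derivative_sum has_derivative_mult_right) auto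

lemma GDERIV_lagrangian_lam:
  "GDERIV (\<lambda>\<alpha>. lagrangian f w x \<alpha>) \<alpha> :> (\<chi> i. w $ i * f i x)"
proof -
  have "(\<lambda>\<alpha>. lagrangian f w x \<alpha>) = (\<lambda>\<alpha>. \<alpha> \<bullet> (\<chi> i. w $ i * f i x))"
    by (simp add: lagrangian_def inner_vec_def mult.assoc)
  then show ?thesis
    unfolding gderiv_def by (auto intro: bounded_linear_imp_has_derivative bounded_linear_inner_left)
qed

section \<open>Histories and averaged outputs\<close>

lemma space_history: "space (history M Z \<xi> t) = space M"
  by (simp add: history_def space_measure_of_conv)

lemma sets_history:
  "sets (history M Z \<xi> t) =
     sigma_sets (space M) {\<xi> s i -` A \<inter> space M | s i A. s \<in> {1..t} \<and> A \<in> sets (Z i)}"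
  unfolding history_def by (rule sets_measure_of) auto

lemma subalgebra_history:
  assumes "\<And>s i. s \<in> {1..t} \<Longrightarrow> \<xi> s i \<in> measurable M (Z i)"
  shows "subalgebra M (history M Z \<xi> t)"
  unfolding subalgebra_def space_history sets_history
  by (intro conjI refl sets.sigma_sets_subset) (auto intro: measurable_sets[OF assms])

lemma subalgebra_history_mono:
  assumes "s \<le> t"
  shows "subalgebra (history M Z \<xi> t) (history M Z \<xi> s)"
  unfolding subalgebra_def space_history sets_history
  by (intro conjI refl sigma_sets_mono') (use assms in fastforce)

lemma adaptive_state_subset: "fst (adaptive_state f x t) \<subseteq> {1..t}"
proof (induction t)
  case (Suc t)
  have "{1..t} \<subseteq> {1..Suc t}" by auto
  with Suc show ?case by (auto simp: Let_def split: prod.splits)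
qed simp

text \<open>Every round contributes one unit of weight, and weight is only ever placed on, or moved
  to, iterates that are no worse in every objective than those it stands for. So the weighted sum of
  each objective never exceeds the plain sum. Nonnegativity belongs to the invariant because moving
  a negative weight would reverse the inequality.\<close>

lemma adaptive_state_weights:
  assumes "adaptive_state f x t = (P, \<gamma>)"
  shows "(\<forall>\<tau>\<in>P. 0 \<le> \<gamma> \<tau>) \<and> sum \<gamma> P = real t \<and> (\<forall>i. (\<Sum>\<tau>\<in>P. \<gamma> \<tau> * f i (x \<tau>)) \<le> (\<Sum>s=1..t. f i (x s)))"
  using assms
proof (induction t arbitrary: P \<gamma>)
  case 0
  then show ?case by auto
next
  case (Suc t)
  obtain Q \<beta> where Q: "adaptive_state f x t = (Q, \<beta>)" by fastforce
  have IH: "\<And>\<tau>. \<tau> \<in> Q \<Longrightarrow> 0 \<le> \<beta> \<tau>" "sum \<beta> Q = real t"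
      "\<And>i. (\<Sum>\<tau>\<in>Q. \<beta> \<tau> * f i (x \<tau>)) \<le> (\<Sum>s=1..t. f i (x s))"
    using Suc.IH[OF Q] by auto
  have Qt: "Q \<subseteq> {1..t}" using adaptive_state_subset[of f x t] Q by simp
  then have fin: "finite Q" and new: "Suc t \<notin> Q" by (auto intro: finite_subset)
  define A where "A = {\<tau> \<in> Q. dominates f (x \<tau>) (x (Suc t))}"
  define B where "B = {\<tau> \<in> Q. dominates f (x (Suc t)) (x \<tau>)}"
  have A: "A \<subseteq> Q" "finite A" and B: "B \<subseteq> Q" "finite B" using fin by (auto simp: A_def B_def)
  have step: "(P, \<gamma>) = (if A \<noteq> {} then (Q, \<lambda>\<tau>. if \<tau> \<in> A then \<beta> \<tau> + 1 / real (card A) else \<beta> \<tau>)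
      else (insert (Suc t) (Q - B), \<beta>(Suc t := 1 + sum \<beta> B)))"
    using Suc.prems unfolding adaptive_state.simps Q Let_def prod.case A_def[symmetric] B_def[symmetric]
    by simp
  show ?case
  proof (cases "A = {}")
    case False
    then have P: "P = Q" and \<gamma>: "\<gamma> = (\<lambda>\<tau>. if \<tau> \<in> A then \<beta> \<tau> + 1 / real (card A) else \<beta> \<tau>)"
      using step by auto
    have card: "real (card A) > 0" using False A(2) by (simp add: card_gt_0_iff)
    \<comment> \<open>Stated for arbitrary \<open>h\<close>: the constant 1 gives the total weight,
      and \<open>h \<tau> = f i (x \<tau>)\<close> gives the objectives. The new unit contributes
      the mean of \<open>h\<close> over the dominating iterates \<open>A\<close>.\<close>
    have sum_eq: "(\<Sum>\<tau>\<in>P. \<gamma> \<tau> * h \<tau>) = (\<Sum>\<tau>\<in>Q. \<beta> \<tau> * h \<tau>) + (\<Sum>\<tau>\<in>A. h \<tau>) / real (card A)" for h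
    proof -
      have "(\<Sum>\<tau>\<in>P. \<gamma> \<tau> * h \<tau>) = (\<Sum>\<tau>\<in>Q. \<beta> \<tau> * h \<tau> + (if \<tau> \<in> A then h \<tau> / real (card A) else 0))"
        unfolding P \<gamma> by (intro sum.cong) (auto simp: field_simps)
      also have "\<dots> = (\<Sum>\<tau>\<in>Q. \<beta> \<tau> * h \<tau>) + (\<Sum>\<tau>\<in>A. h \<tau> / real (card A))"
        using A(1) fin by (simp add: sum.distrib sum.If_cases Int_absorb1)
      finally show ?thesis by (simp add: sum_divide_distrib)
    qed
    have "(\<Sum>\<tau>\<in>A. f i (x \<tau>)) / real (card A) \<le> f i (x (Suc t))" for i
    proof -
      have "(\<Sum>\<tau>\<in>A. f i (x \<tau>)) \<le> (\<Sum>\<tau>\<in>A. f i (x (Suc t)))"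
        by (intro sum_mono) (auto simp: A_def dominates_def)
      then show ?thesis using card by (simp add: field_simps)
    qed
    then have "(\<Sum>\<tau>\<in>P. \<gamma> \<tau> * f i (x \<tau>)) \<le> (\<Sum>s=1..Suc t. f i (x s))" for i
      unfolding sum_eq using IH(3)[of i] by (simp add: add_mono)
    moreover have "sum \<gamma> P = real (Suc t)"
      using sum_eq[of "\<lambda>_. 1"] IH(2) card by simp
    moreover have "\<forall>\<tau>\<in>P. 0 \<le> \<gamma> \<tau>" using IH(1) by (auto simp: P \<gamma>)
    ultimately show ?thesis by blast
  next
    case True
    then have P: "P = insert (Suc t) (Q - B)" and \<gamma>: "\<gamma> = \<beta>(Suc t := 1 + sum \<beta> B)"
      using step by auto
    \<comment> \<open>The new iterate brings its own unit; transferring the weights of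
      \<open>B\<close> to it changes the sum by the last term, which is nonpositive for every
      objective by dominance.\<close>
    have sum_eq: "(\<Sum>\<tau>\<in>P. \<gamma> \<tau> * h \<tau>) = (\<Sum>\<tau>\<in>Q. \<beta> \<tau> * h \<tau>) + h (Suc t) + (\<Sum>\<tau>\<in>B. \<beta> \<tau> * (h (Suc t) - h \<tau>))" for h
    proof -
      have "(\<Sum>\<tau>\<in>Q - B. \<gamma> \<tau> * h \<tau>) = (\<Sum>\<tau>\<in>Q - B. \<beta> \<tau> * h \<tau>)"
        using new by (intro sum.cong) (auto simp: \<gamma>)
      moreover have "(\<Sum>\<tau>\<in>Q - B. \<beta> \<tau> * h \<tau>) = (\<Sum>\<tau>\<in>Q. \<beta> \<tau> * h \<tau>) - (\<Sum>\<tau>\<in>B. \<beta> \<tau> * h \<tau>)"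
        by (rule sum_diff[OF fin B(1)])
      ultimately show ?thesis
        using fin new by (simp add: P \<gamma> algebra_simps sum_subtractf sum_distrib_right)
    qed
    have "(\<Sum>\<tau>\<in>B. \<beta> \<tau> * (f i (x (Suc t)) - f i (x \<tau>))) \<le> 0" for i
      using IH(1) B(1) by (intro sum_nonpos mult_nonneg_nonpos) (auto simp: B_def dominates_def)
    then have "(\<Sum>\<tau>\<in>P. \<gamma> \<tau> * f i (x \<tau>)) \<le> (\<Sum>s=1..Suc t. f i (x s))" for i
      unfolding sum_eq using add_mono[OF IH(3)[of i]] by (simp add: add.assoc add_mono)
    moreover have "sum \<gamma> P = real (Suc t)"
      using sum_eq[of "\<lambda>_. 1"] IH(2) by simp
    moreover have "\<forall>\<tau>\<in>P. 0 \<le> \<gamma> \<tau>"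
      using IH(1) B(1) by (auto simp: P \<gamma> intro!: add_nonneg_nonneg sum_nonneg)
    ultimately show ?thesis by blast
  qed
qed

lemma adaptive_average_convex:
  assumes conv: "convex S" "\<And>i. convex_on S (f i)"
    and x: "\<And>t. t \<in> {1..n} \<Longrightarrow> x t \<in> S" and n: "1 \<le> n"
  shows "adaptive_average f n x \<in> S"
    and "f i (adaptive_average f n x) \<le> (\<Sum>t=1..n. f i (x t)) / real n"
proof -
  obtain P \<gamma> where P: "adaptive_state f x n = (P, \<gamma>)" by fastforce
  note W = adaptive_state_weights[OF P]
  have Pn: "P \<subseteq> {1..n}" using adaptive_state_subset[of f x n] P by simp
  then have fin: "finite P" by (rule finite_subset) simp
  have xP: "x \<tau> \<in> S" if "\<tau> \<in> P" for \<tau> using that Pn x by auto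
  \<comment> \<open>An empty set would have total weight 0, but the total is
    \<open>n\<close>.\<close>
  have ne: "P \<noteq> {}" using W n by auto
  have avg: "adaptive_average f n x = (\<Sum>\<tau>\<in>P. (\<gamma> \<tau> / real n) *\<^sub>R x \<tau>)"
    by (simp add: adaptive_average_def P scaleR_right.sum)
  have one: "(\<Sum>\<tau>\<in>P. \<gamma> \<tau> / real n) = 1" using W n by (simp flip: sum_divide_distrib)
  have nonneg: "0 \<le> \<gamma> \<tau> / real n" if "\<tau> \<in> P" for \<tau> using W that by simp
  show "adaptive_average f n x \<in> S"
    unfolding avg by (rule convex_sum[OF fin conv(1) one nonneg xP])
  have "f i (adaptive_average f n x) \<le> (\<Sum>\<tau>\<in>P. (\<gamma> \<tau> / real n) * f i (x \<tau>))"
    unfolding avg by (rule convex_on_sum[OF fin ne conv(2) one nonneg xP])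
  also have "\<dots> = (\<Sum>\<tau>\<in>P. \<gamma> \<tau> * f i (x \<tau>)) / real n" by (simp add: sum_divide_distrib)
  also have "\<dots> \<le> (\<Sum>t=1..n. f i (x t)) / real n" using W by (intro divide_right_mono) auto
  finally show "f i (adaptive_average f n x) \<le> (\<Sum>t=1..n. f i (x t)) / real n" .
qed

lemma uniform_average_convex:
  assumes conv: "convex S" "convex_on S \<phi>"
    and x: "\<And>t. t \<in> {1..n} \<Longrightarrow> x t \<in> S" and n: "1 \<le> n"
  shows "uniform_average n x \<in> S"
    and "\<phi> (uniform_average n x) \<le> (\<Sum>t=1..n. \<phi> (x t)) / real n"
proof -
  have avg: "uniform_average n x = (\<Sum>t=1..n. (1 / real n) *\<^sub>R x t)"
    by (simp add: uniform_average_def scaleR_right.sum)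
  have one: "(\<Sum>t=1..n. 1 / real n) = 1" using n by simp
  show "uniform_average n x \<in> S"
    unfolding avg by (rule convex_sum[OF _ conv(1) one]) (use x in auto)
  have "\<phi> (uniform_average n x) \<le> (\<Sum>t=1..n. 1 / real n * \<phi> (x t))"
    unfolding avg by (rule convex_on_sum[OF _ _ conv(2) one]) (use x n in auto)
  then show "\<phi> (uniform_average n x) \<le> (\<Sum>t=1..n. \<phi> (x t)) / real n"
    by (simp add: sum_divide_distrib)
qed

lemma adaptive_state_cong:
  assumes "\<And>s t. s \<in> {1..n} \<Longrightarrow> t \<in> {1..n} \<Longrightarrow> dominates f (x s) (x t) \<longleftrightarrow> dominates f (y s) (y t)"
  shows "adaptive_state f x n = adaptive_state f y n"
  using assms
proof (induction n)
  case (Suc n)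
  have IH: "adaptive_state f x n = adaptive_state f y n" by (rule Suc.IH) (use Suc.prems in auto)
  obtain P \<gamma> where P: "adaptive_state f y n = (P, \<gamma>)" by fastforce
  then have mem: "\<tau> \<in> {1..Suc n}" if "\<tau> \<in> P" for \<tau>
    using adaptive_state_subset[of f y n] that by auto
  have eqs: "{\<tau> \<in> P. dominates f (x \<tau>) (x (Suc n))} = {\<tau> \<in> P. dominates f (y \<tau>) (y (Suc n))}"
    "{\<tau> \<in> P. dominates f (x (Suc n)) (x \<tau>)} = {\<tau> \<in> P. dominates f (y (Suc n)) (y \<tau>)}"
    using Suc.prems[OF mem, of _ "Suc n"] Suc.prems[OF _ mem, of "Suc n"] by auto
  show ?case by (simp only: adaptive_state.simps IH P Let_def prod.case eqs)
qed simp

text \<open>The state depends on the iterates only through the dominance relation between them, of which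
  there are finitely many.\<close>

lemma borel_measurable_adaptive_average:
  fixes f :: "'m::finite \<Rightarrow> 'a::euclidean_space \<Rightarrow> real" and x :: "nat \<Rightarrow> 'w \<Rightarrow> 'a"
  assumes x: "\<And>t. t \<in> {1..n} \<Longrightarrow> x t \<in> borel_measurable M"
    and fx: "\<And>i t. t \<in> {1..n} \<Longrightarrow> (\<lambda>\<omega>. f i (x t \<omega>)) \<in> borel_measurable M"
  shows "(\<lambda>\<omega>. adaptive_average f n (\<lambda>t. x t \<omega>)) \<in> borel_measurable M"
proof -
  define pat where "pat \<omega> = {(s, t) \<in> {1..n} \<times> {1..n}. dominates f (x s \<omega>) (x t \<omega>)}" for \<omega>
  \<comment> \<open>The state belonging to the dominance pattern \<open>K\<close>, computed at an
    arbitrary outcome showing that pattern. If no outcome shows \<open>K\<close> the choice is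
    meaningless but harmless, since \<open>st\<close> is evaluated at \<open>pat \<omega>\<close>
    and its index set lies within the rounds in any case.\<close>
  define st where "st K = adaptive_state f (\<lambda>t. x t (SOME \<omega>. pat \<omega> = K)) n" for K
  have st: "adaptive_state f (\<lambda>t. x t \<omega>) n = st (pat \<omega>)" for \<omega>
  proof -
    have "pat (SOME \<omega>'. pat \<omega>' = pat \<omega>) = pat \<omega>" by (rule someI) simp
    then show ?thesis
      unfolding st_def by (intro adaptive_state_cong) (auto simp: pat_def set_eq_iff)
  qed
  have dom: "{\<omega> \<in> space M. dominates f (x s \<omega>) (x t \<omega>)} \<in> sets M" if "s \<in> {1..n}" "t \<in> {1..n}" for s t
  proof -
    note [measurable] = fx[OF that(1)] fx[OF that(2)]
    show ?thesis unfolding dominates_def by measurable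
  qed
  have "pat \<in> measurable M (count_space (Pow ({1..n} \<times> {1..n})))"
  proof (rule measurable_count_space_eq2[THEN iffD2], simp, intro conjI ballI)
    show "pat \<in> space M \<rightarrow> Pow ({1..n} \<times> {1..n})" by (auto simp: pat_def)
    fix K assume "K \<in> Pow ({1..n} \<times> {1..n})"
    then have "pat -` {K} \<inter> space M = {\<omega> \<in> space M. \<forall>(s, t)\<in>{1..n} \<times> {1..n}.
        dominates f (x s \<omega>) (x t \<omega>) \<longleftrightarrow> (s, t) \<in> K}"
      by (auto simp: pat_def set_eq_iff) blast
    also have "\<dots> \<in> sets M"
    proof (rule sets.sets_Collect_finite_All)
      show "{\<omega> \<in> space M. case p of (s, t) \<Rightarrow> dominates f (x s \<omega>) (x t \<omega>) \<longleftrightarrow> (s, t) \<in> K} \<in> sets M"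
        if "p \<in> {1..n} \<times> {1..n}" for p
        using that dom[of "fst p" "snd p"]
        by (cases "p \<in> K") (auto simp: case_prod_beta intro!: sets.sets_Collect_neg)
    qed simp
    finally show "pat -` {K} \<inter> space M \<in> sets M" .
  qed
  moreover have "(\<lambda>\<omega>. case st K of (P, \<gamma>) \<Rightarrow> (1 / real n) *\<^sub>R (\<Sum>\<tau>\<in>P. \<gamma> \<tau> *\<^sub>R x \<tau> \<omega>)) \<in> borel_measurable M" for K
  proof -
    obtain P \<gamma> where P: "st K = (P, \<gamma>)" by fastforce
    then have "P \<subseteq> {1..n}"
      using adaptive_state_subset[of f "\<lambda>t. x t (SOME \<omega>. pat \<omega> = K)" n] by (simp add: st_def)
    then show ?thesis
      unfolding P prod.case by (intro borel_measurable_scaleR borel_measurable_sum x) auto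
  qed
  ultimately have "(\<lambda>\<omega>. case st (pat \<omega>) of (P, \<gamma>) \<Rightarrow> (1 / real n) *\<^sub>R (\<Sum>\<tau>\<in>P. \<gamma> \<tau> *\<^sub>R x \<tau> \<omega>)) \<in> borel_measurable M"
    by (intro measurable_compose_countable'[where g = pat and I = "Pow ({1..n} \<times> {1..n})"
          and f = "\<lambda>K \<omega>. case st K of (P, \<gamma>) \<Rightarrow> (1 / real n) *\<^sub>R (\<Sum>\<tau>\<in>P. \<gamma> \<tau> *\<^sub>R x \<tau> \<omega>)"])
      (auto intro: countable_finite)
  then show ?thesis by (simp add: adaptive_average_def st)
qed

lemma borel_measurable_TCH:
  assumes "\<And>i. (\<lambda>\<omega>. f i (x \<omega>)) \<in> borel_measurable M"
  shows "(\<lambda>\<omega>. TCH f w (x \<omega>)) \<in> borel_measurable M"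
  unfolding TCH_def using assms by (intro borel_measurable_Max borel_measurable_times) auto

text \<open>Nothing is known about the objectives outside \<Theta>, so they need not be Borel on the
  whole space. Cutting off by the indicator of the closed set gives a Borel function without
  changing the composite.\<close>

lemma borel_measurable_comp_continuous_on:
  fixes \<phi> :: "'a::euclidean_space \<Rightarrow> real"
  assumes "continuous_on S \<phi>" "closed S" "x \<in> borel_measurable M" "\<And>\<omega>. \<omega> \<in> space M \<Longrightarrow> x \<omega> \<in> S"
  shows "(\<lambda>\<omega>. \<phi> (x \<omega>)) \<in> borel_measurable M"
proof -
  have "(\<lambda>\<omega>. indicator S (x \<omega>) *\<^sub>R \<phi> (x \<omega>)) \<in> borel_measurable M"
    using assms by (intro measurable_compose[OF _ borel_measurable_continuous_on_indicator]) auto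
  moreover have "(\<lambda>\<omega>. indicator S (x \<omega>) *\<^sub>R \<phi> (x \<omega>)) \<in> borel_measurable M \<longleftrightarrow> (\<lambda>\<omega>. \<phi> (x \<omega>)) \<in> borel_measurable M"
    by (rule measurable_cong) (simp add: assms)
  ultimately show ?thesis by simp
qed

section \<open>Regret and the Tchebycheff gap\<close>

text \<open>This \<eta> balances the two terms, each becoming
  \<open>sqrt 10 * sqrt (a * b) * sqrt n\<close>. For the parameters \<open>a = R^2\<close> and
  \<open>b = L^2\<close> after the common factor \<open>d\<close> is taken out; for the weights
  \<open>a = 1\<close> and \<open>b = m * U^2\<close>.\<close>

lemma optimal_step_size:
  fixes a b n :: real
  assumes "0 < a" "0 < b" "0 < n"
  defines "\<eta> \<equiv> sqrt (8 * a / (5 * n * b))"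
  shows "4 * a / \<eta> + 5 / 2 * \<eta> * n * b = 2 * sqrt 10 * sqrt (a * b) * sqrt n"
proof -
  have \<eta>: "0 < \<eta>" using assms by (simp add: \<eta>_def)
  have sq: "\<eta> * \<eta> = 8 * a / (5 * n * b)"
    using assms(1-3) by (simp add: \<eta>_def)
  have "4 * a = 5 / 2 * n * b * (\<eta> * \<eta>)" unfolding sq using assms(1-3) by (simp add: field_simps)
  then have "4 * a / \<eta> + 5 / 2 * \<eta> * n * b = 5 * n * b * \<eta>"
    using \<eta> by (simp add: field_simps)
  also have "\<dots> = sqrt ((5 * n * b)\<^sup>2) * \<eta>" using assms(1-3) by simp
  also have "\<dots> = sqrt ((5 * n * b)\<^sup>2 * (8 * a / (5 * n * b)))"
    unfolding \<eta>_def by (simp only: real_sqrt_mult)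
  also have "(5 * n * b)\<^sup>2 * (8 * a / (5 * n * b)) = 2\<^sup>2 * 10 * (a * b) * n"
    using assms(1-3) by (simp add: field_simps power2_eq_square)
  also have "sqrt \<dots> = 2 * sqrt 10 * sqrt (a * b) * sqrt n"
    by (simp only: real_sqrt_mult) simp
  finally show ?thesis .
qed

lemma infnorm_weighted_sum_le:
  fixes D :: "'m::finite \<Rightarrow> real ^ 'd"
  assumes "\<And>i. 0 \<le> a i" "(\<Sum>i\<in>UNIV. a i) \<le> 1" "\<And>i. infnorm (D i) \<le> b" "0 \<le> b"
  shows "infnorm (\<Sum>i\<in>UNIV. a i *\<^sub>R D i) \<le> b"
  unfolding infnorm_le_iff_cart
proof
  fix j
  have "\<bar>(\<Sum>i\<in>UNIV. a i *\<^sub>R D i) $ j\<bar> \<le> (\<Sum>i\<in>UNIV. \<bar>a i * D i $ j\<bar>)"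
    by (simp add: sum_abs)
  also have "\<dots> \<le> (\<Sum>i\<in>UNIV. a i * b)"
    using assms by (intro sum_mono) (auto simp: abs_mult infnorm_le_iff_cart intro!: mult_left_mono)
  also have "\<dots> \<le> 1 * b"
    unfolding sum_distrib_right[symmetric] using assms by (intro mult_right_mono) auto
  finally show "\<bar>(\<Sum>i\<in>UNIV. a i *\<^sub>R D i) $ j\<bar> \<le> b" by simp
qed

lemma sum_mult_simplex_le_1:
  fixes \<alpha> w :: "real ^ 'm::finite"
  assumes "\<alpha> \<in> simplex_set" "w \<in> simplex_set"
  shows "(\<Sum>i\<in>UNIV. \<alpha> $ i * w $ i) \<le> 1"
proof -
  have "(\<Sum>i\<in>UNIV. \<alpha> $ i * w $ i) \<le> (\<Sum>i\<in>UNIV. \<alpha> $ i * 1)"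
    using assms simplex_set_component_le_1[OF assms(2)]
    by (intro sum_mono mult_left_mono) (auto simp: simplex_set_def)
  then show ?thesis using assms by (simp add: simplex_set_def)
qed

text \<open>Known bounded coefficients are pulled out of the conditional expectation. This turns
  unbiasedness of the separate gradient estimates into that of \<open>g_theta\<close>, whose
  coefficients involve only the current weights, known before the round.\<close>

lemma (in sigma_finite_subalgebra) real_cond_exp_weighted_sum:
  fixes a Y y :: "'m::finite \<Rightarrow> 'a \<Rightarrow> real"
  assumes a: "\<And>i. a i \<in> borel_measurable F" "\<And>i \<omega>. \<omega> \<in> space M \<Longrightarrow> \<bar>a i \<omega>\<bar> \<le> b"
    and Y: "\<And>i. integrable M (Y i)"
    and y: "\<And>i. AE \<omega> in M. real_cond_exp M F (Y i) \<omega> = y i \<omega>"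
  shows "AE \<omega> in M. real_cond_exp M F (\<lambda>\<omega>. \<Sum>i\<in>UNIV. a i \<omega> * Y i \<omega>) \<omega> = (\<Sum>i\<in>UNIV. a i \<omega> * y i \<omega>)"
proof -
  have int: "integrable M (\<lambda>\<omega>. a i \<omega> * Y i \<omega>)" for i
  proof (rule Bochner_Integration.integrable_bound)
    show "integrable M (\<lambda>\<omega>. b * Y i \<omega>)" using Y by simp
    show "AE \<omega> in M. norm (a i \<omega> * Y i \<omega>) \<le> norm (b * Y i \<omega>)"
      using AE_space by eventually_elim (force simp: abs_mult intro!: mult_right_mono dest: a(2)[of _ i])
  qed (use Y measurable_from_subalg[OF subalg a(1)] in auto)
  have "AE \<omega> in M. \<forall>i\<in>UNIV. real_cond_exp M F (\<lambda>\<omega>. a i \<omega> * Y i \<omega>) \<omega> = a i \<omega> * y i \<omega>"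
  proof (intro AE_finite_allI)
    fix i
    show "AE \<omega> in M. real_cond_exp M F (\<lambda>\<omega>. a i \<omega> * Y i \<omega>) \<omega> = a i \<omega> * y i \<omega>"
      using real_cond_exp_mult[OF a(1) borel_measurable_integrable[OF Y] int, of i] y[of i]
      by eventually_elim simp
  qed simp
  then show ?thesis
    using real_cond_exp_sum[of "\<lambda>i \<omega>. a i \<omega> * Y i \<omega>" UNIV, OF int] by eventually_elim simp
qed

text \<open>With \<open>i\<close> a maximising objective at \<open>xh\<close>, the average of
  \<open>w $ i * f i\<close> over the iterates dominates \<open>TCH f w xh\<close>. It is compared
  with the averaged Lagrangian values by the regret against vertex \<open>i\<close>, then with the
  Lagrangian at \<open>u\<close> by linearising each convex objective, and finally with
  \<open>TCH f w u\<close>, since a weighted average is at most the maximum. The vertex depends on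
  \<open>xh\<close>, hence \<open>reg_\<alpha>\<close> ranges over the whole simplex.\<close>

lemma TCH_gap_le_regret:
  fixes f :: "'m::finite \<Rightarrow> 'a::euclidean_space \<Rightarrow> real"
  assumes n: "1 \<le> n"
    and diff: "\<And>i x. x \<in> S \<Longrightarrow> f i differentiable (at x)"
    and conv: "\<And>i. convex_on S (f i)"
    and w: "\<And>i. 0 \<le> w $ i"
    and x: "\<And>t. t \<in> {1..n} \<Longrightarrow> x t \<in> S"
    and \<alpha>: "\<And>t. t \<in> {1..n} \<Longrightarrow> \<alpha> t \<in> simplex_set"
    and xh: "\<And>i. f i xh \<le> (\<Sum>t=1..n. f i (x t)) / real n"
    and u: "u \<in> S"
    and reg_x: "(\<Sum>t=1..n. (\<Sum>i\<in>UNIV. (\<alpha> t $ i * w $ i) *\<^sub>R gradient (f i) (x t)) \<bullet> (x t - u)) \<le> bx"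
    and reg_\<alpha>: "\<And>v. v \<in> simplex_set \<Longrightarrow> (\<Sum>t=1..n. - (\<chi> i. w $ i * f i (x t)) \<bullet> (\<alpha> t - v)) \<le> b\<alpha>"
  shows "real n * (TCH f w xh - TCH f w u) \<le> bx + b\<alpha>"
proof -
  obtain i where i: "TCH f w xh = w $ i * f i xh" by (rule TCH_attained)
  have lag: "(\<chi> i. w $ i * f i y) \<bullet> \<beta> = lagrangian f w y \<beta>" for y \<beta>
    by (simp add: lagrangian_def inner_vec_def ac_simps)
  have "lagrangian f w (x t) (\<alpha> t) - lagrangian f w u (\<alpha> t)
      \<le> (\<Sum>i\<in>UNIV. (\<alpha> t $ i * w $ i) *\<^sub>R gradient (f i) (x t)) \<bullet> (x t - u)" if t: "t \<in> {1..n}" for t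
  proof -
    have "lagrangian f w (x t) (\<alpha> t) - lagrangian f w u (\<alpha> t) = (\<Sum>i\<in>UNIV. (\<alpha> t $ i * w $ i) * (f i (x t) - f i u))"
      by (simp add: lagrangian_def sum_subtractf algebra_simps)
    also have "\<dots> \<le> (\<Sum>i\<in>UNIV. (\<alpha> t $ i * w $ i) * (gradient (f i) (x t) \<bullet> (x t - u)))"
    proof (intro sum_mono mult_left_mono)
      fix i
      show "f i (x t) - f i u \<le> gradient (f i) (x t) \<bullet> (x t - u)"
        using convex_on_ge_gradient[OF conv diff[OF x[OF t]] x[OF t] u, of i] by (simp add: inner_diff_right)
      show "0 \<le> \<alpha> t $ i * w $ i" using \<alpha>[OF t] w by (simp add: simplex_set_def)
    qed
    finally show ?thesis by (simp add: inner_sum_left)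
  qed
  then have "(\<Sum>t=1..n. lagrangian f w (x t) (\<alpha> t) - lagrangian f w u (\<alpha> t)) \<le> bx"
    by (intro order_trans[OF sum_mono reg_x]) auto
  moreover have "(\<Sum>t=1..n. lagrangian f w u (\<alpha> t)) \<le> real n * TCH f w u"
  proof -
    have "(\<Sum>t=1..n. lagrangian f w u (\<alpha> t)) \<le> (\<Sum>t=1..n. TCH f w u)"
      by (intro sum_mono lagrangian_le_TCH \<alpha>)
    then show ?thesis by simp
  qed
  \<comment> \<open>The Lagrangian is linear in the weights, so its regret is exact, and at the
    vertex \<open>axis i 1\<close> it picks out objective \<open>i\<close>. The minus sign in
    \<open>reg_\<alpha>\<close> reflects that this player maximises.\<close>
  moreover have "(\<Sum>t=1..n. w $ i * f i (x t) - lagrangian f w (x t) (\<alpha> t)) \<le> b\<alpha>"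
    using reg_\<alpha>[OF axis_mem_simplex_set[of i]] by (simp add: inner_diff_right lag inner_axis)
  moreover have "real n * TCH f w xh \<le> (\<Sum>t=1..n. w $ i * f i (x t))"
    using mult_left_mono[OF xh[of i] w[of i]] n by (simp add: i field_simps sum_distrib_left)
  ultimately show ?thesis by (simp add: sum_subtractf algebra_simps)
qed

theorem corollary3p4:
  fixes f :: "'m::finite \<Rightarrow> real ^ 'd \<Rightarrow> real"
    and w :: "real ^ 'm"
    and \<Theta> :: "(real ^ 'd) set"
    and U L R :: real
    and T :: nat
    and \<eta>_theta \<eta>_lam :: real
    and M :: "'w measure"
    and Z :: "'m \<Rightarrow> 'z measure"
    and \<xi> :: "nat \<Rightarrow> 'm \<Rightarrow> 'w \<Rightarrow> 'z"
    and \<delta>f :: "nat \<Rightarrow> 'm \<Rightarrow> 'w \<Rightarrow> real ^ 'd"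
    and fhat :: "nat \<Rightarrow> 'm \<Rightarrow> 'w \<Rightarrow> real"
    and \<theta>1 :: "real ^ 'd"
    and \<theta> :: "nat \<Rightarrow> 'w \<Rightarrow> real ^ 'd"
    and lam :: "nat \<Rightarrow> 'w \<Rightarrow> real ^ 'm"
    and g_theta :: "nat \<Rightarrow> 'w \<Rightarrow> real ^ 'd"
    and g_lam :: "nat \<Rightarrow> 'w \<Rightarrow> real ^ 'm"
    and \<theta>hat :: "'w \<Rightarrow> real ^ 'd"
  assumes T: "1 \<le> T"
    and Theta: "\<Theta> \<noteq> {}" "closed \<Theta>" "convex \<Theta>"
    and w: "w \<in> simplex_set"
    and pos: "0 < U" "0 < L" "0 < R"
    and f_diff: "\<And>i x. x \<in> \<Theta> \<Longrightarrow> f i differentiable (at x)"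
    and f_nonneg: "\<And>i x. x \<in> \<Theta> \<Longrightarrow> 0 \<le> f i x"
    and f_convex: "\<And>i. convex_on \<Theta> (f i)"
    and f_bound: "\<And>i x. x \<in> \<Theta> \<Longrightarrow> f i x \<le> U"
    and f_grad: "\<And>i x. x \<in> \<Theta> \<Longrightarrow> infnorm (gradient (f i) x) \<le> L"
    and Theta_bound: "\<And>x. x \<in> \<Theta> \<Longrightarrow> infnorm x \<le> R"
    and M: "prob_space M"
    and batches: "\<And>t i. t \<in> {1..T} \<Longrightarrow> \<xi> t i \<in> measurable M (Z i)"
    and \<delta>f_meas: "\<And>t i. t \<in> {1..T} \<Longrightarrow> \<delta>f t i \<in> borel_measurable (history M Z \<xi> t)"
    and fhat_meas: "\<And>t i. t \<in> {1..T} \<Longrightarrow> fhat t i \<in> borel_measurable (history M Z \<xi> t)"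
    and \<delta>f_int: "\<And>t i. t \<in> {1..T} \<Longrightarrow> integrable M (\<delta>f t i)"
    and fhat_int: "\<And>t i. t \<in> {1..T} \<Longrightarrow> integrable M (fhat t i)"
    and \<delta>f_unbiased: "\<And>t i j. t \<in> {1..T} \<Longrightarrow>
          AE \<omega> in M. real_cond_exp M (history M Z \<xi> (t - 1)) (\<lambda>\<omega>. \<delta>f t i \<omega> $ j) \<omega>
                       = gradient (f i) (\<theta> t \<omega>) $ j"
    and fhat_unbiased: "\<And>t i. t \<in> {1..T} \<Longrightarrow>
          AE \<omega> in M. real_cond_exp M (history M Z \<xi> (t - 1)) (fhat t i) \<omega> = f i (\<theta> t \<omega>)"
    and g_theta: "g_theta = (\<lambda>t \<omega>. stoch_grad_theta w (lam t \<omega>) (\<lambda>i. \<delta>f t i \<omega>))"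
    and g_lam: "g_lam = (\<lambda>t \<omega>. stoch_grad_lam w (\<lambda>i. fhat t i \<omega>))"
    and g_theta_bound: "\<And>t. t \<in> {1..T} \<Longrightarrow> AE \<omega> in M. infnorm (g_theta t \<omega>) \<le> L"
    and g_lam_bound: "\<And>t. t \<in> {1..T} \<Longrightarrow> AE \<omega> in M. infnorm (g_lam t \<omega>) \<le> U"
    and init: "\<theta>1 \<in> \<Theta>"
      "\<And>\<omega>. \<omega> \<in> space M \<Longrightarrow> \<theta> 1 \<omega> = \<theta>1"
      "\<And>\<omega>. \<omega> \<in> space M \<Longrightarrow> lam 1 \<omega> = (\<chi> i. 1 / real CARD('m))"
    and \<theta>_update: "\<And>t \<omega>. t \<in> {1..T} \<Longrightarrow> \<omega> \<in> space M \<Longrightarrow>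
          \<theta> (Suc t) \<omega> = closest_point \<Theta> (\<theta> t \<omega> - \<eta>_theta *\<^sub>R g_theta t \<omega>)"
    and lam_update: "\<And>t \<omega>. t \<in> {1..T} \<Longrightarrow> \<omega> \<in> space M \<Longrightarrow>
          lam (Suc t) \<omega> = closest_point simplex_set (lam t \<omega> + \<eta>_lam *\<^sub>R g_lam t \<omega>)"
    and \<theta>hat: "\<theta>hat = (\<lambda>\<omega>. uniform_average T (\<lambda>t. \<theta> t \<omega>)) \<or>
                 \<theta>hat = (\<lambda>\<omega>. adaptive_average f T (\<lambda>t. \<theta> t \<omega>))"
  shows "associated_constants M f w \<Theta> U L T \<theta> lam \<theta>hat g_theta g_lam
           (\<lambda>x. 1 / 2 * (norm x)\<^sup>2) norm (\<lambda>\<alpha>. 1 / 2 * (norm \<alpha>)\<^sup>2) norm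
           1 1 (2 * real CARD('d) * R\<^sup>2) 2 (real CARD('d)) (real CARD('m))
         \<and>
         (\<eta>_theta = sqrt (8 * R\<^sup>2 / (5 * real T * L\<^sup>2)) \<longrightarrow>
          \<eta>_lam = sqrt (8 / (5 * real T * real CARD('m) * U\<^sup>2)) \<longrightarrow>
          (\<forall>\<gamma>. 0 < \<gamma> \<longrightarrow> \<gamma> < 1 \<longrightarrow>
             measure M {\<omega> \<in> space M.
               TCH f w (\<theta>hat \<omega>) - (INF x\<in>\<Theta>. TCH f w x)
                 \<le> 2 * sqrt 10 * real CARD('d) * R * L / sqrt (real T)
                   + 2 * sqrt 10 * sqrt (real CARD('m)) * U / sqrt (real T)
                   + 4 * (real CARD('d) * R * L + U) * sqrt (2 / real T * ln (1 / \<gamma>))}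
             \<ge> 1 - \<gamma>))"
proof -
  interpret prob_space M by (rule M)

  \<comment> \<open>Filtration and true gradients\<close>
  define F where "F = history M Z \<xi>"
  define G_theta where
    "G_theta t \<omega> = (\<Sum>i\<in>UNIV. (lam t \<omega> $ i * w $ i) *\<^sub>R gradient (f i) (\<theta> t \<omega>))" for t \<omega>
  define G_lam :: "nat \<Rightarrow> 'w \<Rightarrow> real ^ 'm" where
    "G_lam t \<omega> = (\<chi> i. w $ i * f i (\<theta> t \<omega>))" for t \<omega>
  have sub: "subalgebra M (F t)" if "t \<le> T" for t
    unfolding F_def using that by (intro subalgebra_history batches) auto
  have mono: "subalgebra (F t) (F s)" if "s \<le> t" for s t
    unfolding F_def using that by (rule subalgebra_history_mono)
  have sp: "space (F t) = space M" for t by (simp add: F_def space_history)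
  have \<delta>f_F: "\<delta>f t i \<in> borel_measurable (F t)" and fhat_F: "fhat t i \<in> borel_measurable (F t)"
    if "t \<in> {1..T}" for t i
    using \<delta>f_meas[OF that] fhat_meas[OF that] by (simp_all add: F_def)
  have w0: "0 \<le> w $ i" and w1: "w $ i \<le> 1" for i
    using w simplex_set_component_le_1[OF w] by (auto simp: simplex_set_def)
  have f_cont: "continuous_on \<Theta> (f i)" for i
    using f_diff differentiable_imp_continuous_within by (intro continuous_at_imp_continuous_on) blast

  \<comment> \<open>Measurability and feasibility of the iterates\<close>
  have g_lam_F: "(\<lambda>\<omega>. - g_lam t \<omega>) \<in> borel_measurable (F t)" if "t \<in> {1..T}" for t
    unfolding borel_measurable_cart_iff g_lam stoch_grad_lam_def using fhat_F[OF that] by simp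
  \<comment> \<open>Ascent along \<open>g_lam\<close> is read as descent along its negative, so that
    both players fall under the same lemmas.\<close>
  have lam_step: "lam (Suc t) \<omega> = closest_point simplex_set (lam t \<omega> - \<eta>_lam *\<^sub>R (- g_lam t \<omega>))"
    if "t \<in> {1..T}" "\<omega> \<in> space M" for t \<omega>
    using lam_update[OF that] by simp
  note lam_F = projected_gradient_adapted[where x = lam and g = "\<lambda>t \<omega>. - g_lam t \<omega>" and F = F and n = T,
      OF convex_simplex_set closed_simplex_set uniform_mem_simplex_set sp mono init(3) g_lam_F lam_step]
  have lam_pred: "lam t \<in> borel_measurable (F (t - 1))" if "t \<in> {1..T}" for t
    using lam_F(1)[where k = "t - 1"] that by auto
  have lam_simplex: "lam t \<omega> \<in> simplex_set" if "t \<in> {1..T}" "\<omega> \<in> space M" for t \<omega>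
    using lam_F(2)[where k = "t - 1" and \<omega> = \<omega>] that by auto

  \<comment> \<open>The weights have to be treated before the parameters: \<open>g_theta t\<close>
    contains \<open>lam t\<close>, whereas \<open>g_lam t\<close> is built from the value estimates
    alone.\<close>
  have g_theta_F: "g_theta t \<in> borel_measurable (F t)" if t: "t \<in> {1..T}" for t
  proof -
    have "lam t \<in> borel_measurable (F t)"
      by (rule measurable_from_subalg[OF mono lam_pred[OF t]]) simp
    then have "(\<lambda>\<omega>. lam t \<omega> $ i) \<in> borel_measurable (F t)" for i
      unfolding borel_measurable_cart_iff by blast
    then show ?thesis
      unfolding g_theta stoch_grad_theta_def using \<delta>f_F[OF t]
      by (intro borel_measurable_sum borel_measurable_scaleR borel_measurable_times) auto
  qed
  note \<theta>_F = projected_gradient_adapted[where x = \<theta> and g = g_theta and F = F and n = T,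
      OF Theta(3,2) init(1) sp mono init(2) g_theta_F \<theta>_update]
  have \<theta>_M: "\<theta> t \<in> borel_measurable M" if "t \<in> {1..T}" for t
    using measurable_from_subalg[OF sub \<theta>_F(1)[where k = "t - 1"]] that by auto
  have \<theta>_Theta: "\<theta> t \<omega> \<in> \<Theta>" if "t \<in> {1..T}" "\<omega> \<in> space M" for t \<omega>
    using \<theta>_F(2)[where k = "t - 1" and \<omega> = \<omega>] that by auto

  \<comment> \<open>Sup-norm bounds for the true gradients\<close>
  have G_theta_bound: "infnorm (G_theta t \<omega>) \<le> L" if "t \<in> {1..T}" "\<omega> \<in> space M" for t \<omega>
    unfolding G_theta_def using lam_simplex[OF that] w0 pos
    by (intro infnorm_weighted_sum_le f_grad \<theta>_Theta[OF that] sum_mult_simplex_le_1 w)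
      (auto simp: simplex_set_def)
  have G_lam_bound: "infnorm (G_lam t \<omega>) \<le> U" if "t \<in> {1..T}" "\<omega> \<in> space M" for t \<omega>
    unfolding infnorm_le_iff_cart
  proof
    fix i
    have "w $ i * f i (\<theta> t \<omega>) \<le> 1 * U"
      using w0 w1 f_bound f_nonneg \<theta>_Theta[OF that] pos by (intro mult_mono) auto
    then show "\<bar>G_lam t \<omega> $ i\<bar> \<le> U"
      using w0 f_nonneg \<theta>_Theta[OF that] by (simp add: G_lam_def)
  qed

  \<comment> \<open>The averaged output\<close>
  have \<theta>hat_Theta: "\<theta>hat \<omega> \<in> \<Theta>"
    and \<theta>hat_le: "f i (\<theta>hat \<omega>) \<le> (\<Sum>t=1..T. f i (\<theta> t \<omega>)) / real T" if "\<omega> \<in> space M" for \<omega> i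
    using \<theta>hat uniform_average_convex[where x = "\<lambda>t. \<theta> t \<omega>", OF Theta(3) f_convex \<theta>_Theta[OF _ that] T]
      adaptive_average_convex[where f = f and x = "\<lambda>t. \<theta> t \<omega>", OF Theta(3) f_convex \<theta>_Theta[OF _ that] T]
    by auto
  have \<theta>hat_M: "\<theta>hat \<in> borel_measurable M"
  proof -
    have "(\<lambda>\<omega>. f i (\<theta> t \<omega>)) \<in> borel_measurable M" if "t \<in> {1..T}" for i t
      using that by (intro borel_measurable_comp_continuous_on[OF f_cont Theta(2)] \<theta>_M \<theta>_Theta)
    then have "(\<lambda>\<omega>. adaptive_average f T (\<lambda>t. \<theta> t \<omega>)) \<in> borel_measurable M"
      using \<theta>_M by (intro borel_measurable_adaptive_average)
    moreover have "(\<lambda>\<omega>. uniform_average T (\<lambda>t. \<theta> t \<omega>)) \<in> borel_measurable M"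
      unfolding uniform_average_def by (intro borel_measurable_scaleR borel_measurable_sum \<theta>_M) auto
    ultimately show ?thesis using \<theta>hat by auto
  qed

  \<comment> \<open>Diameters and the associated constants\<close>
  have diam_Theta: "(norm (x - y))\<^sup>2 \<le> 4 * real CARD('d) * R\<^sup>2" if "x \<in> \<Theta>" "y \<in> \<Theta>" for x y
  proof -
    have "infnorm (x - y) \<le> 2 * R"
      using infnorm_triangle[of x "- y"] Theta_bound[OF that(1)] Theta_bound[OF that(2)] by (simp add: infnorm_neg)
    from norm_square_le_infnorm_cart[OF this] show ?thesis by (simp add: power_mult_distrib)
  qed
  have diam_simplex: "(norm ((\<chi> i. 1 / real CARD('m)) - v))\<^sup>2 \<le> 2 * 2" if "v \<in> simplex_set" for v :: "real ^ 'm"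
    using norm_diff_simplex_le[OF uniform_mem_simplex_set that] by simp

  have "associated_constants M f w \<Theta> U L T \<theta> lam \<theta>hat g_theta g_lam
      (\<lambda>x. 1 / 2 * (norm x)\<^sup>2) norm (\<lambda>\<alpha>. 1 / 2 * (norm \<alpha>)\<^sup>2) norm
      1 1 (2 * real CARD('d) * R\<^sup>2) 2 (real CARD('d)) (real CARD('m))"
    unfolding associated_constants_def bregman_half_norm_square dual_norm_norm
  proof (intro conjI ballI allI impI strongly_convex_half_norm_square zero_less_one)
    fix \<omega> \<theta>_star assume "\<omega> \<in> space M"
      "is_arg_min (\<lambda>x. lagrangian f w x (uniform_average T (\<lambda>t. lam t \<omega>))) (\<lambda>x. x \<in> \<Theta>) \<theta>_star"
    then show "1 / 2 * (norm (\<theta>_star - \<theta> 1 \<omega>))\<^sup>2 \<le> 2 * real CARD('d) * R\<^sup>2"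
      using diam_Theta[of \<theta>_star \<theta>1] init(1) by (auto simp: is_arg_min_def init(2)[unfolded One_nat_def])
  next
    fix \<omega> lam_star assume "\<omega> \<in> space M"
      "is_arg_max (\<lambda>\<alpha>. lagrangian f w (\<theta>hat \<omega>) \<alpha>) (\<lambda>\<alpha>. \<alpha> \<in> simplex_set) lam_star"
    then show "1 / 2 * (norm (lam_star - lam 1 \<omega>))\<^sup>2 \<le> 2"
      using norm_diff_simplex_le[of lam_star "\<chi> i. 1 / real CARD('m)"] uniform_mem_simplex_set
      by (auto simp: is_arg_max_def init(3)[unfolded One_nat_def])
  next
    fix t \<omega> assume t: "t \<in> {1..T}" "\<omega> \<in> space M"
    have "gradient (\<lambda>x. lagrangian f w x (lam t \<omega>)) (\<theta> t \<omega>) = G_theta t \<omega>"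
      unfolding G_theta_def
      by (intro gradientI GDERIV_lagrangian_theta GDERIV_gradient f_diff \<theta>_Theta t)
    then show "(norm (gradient (\<lambda>x. lagrangian f w x (lam t \<omega>)) (\<theta> t \<omega>)))\<^sup>2 \<le> real CARD('d) * L\<^sup>2"
      using norm_square_le_infnorm_cart[OF G_theta_bound[OF t]] by simp
    have "gradient (\<lambda>\<alpha>. lagrangian f w (\<theta> t \<omega>) \<alpha>) (lam t \<omega>) = G_lam t \<omega>"
      unfolding G_lam_def by (intro gradientI GDERIV_lagrangian_lam)
    then show "(norm (gradient (\<lambda>\<alpha>. lagrangian f w (\<theta> t \<omega>) \<alpha>) (lam t \<omega>)))\<^sup>2 \<le> real CARD('m) * U\<^sup>2"
      using norm_square_le_infnorm_cart[OF G_lam_bound[OF t]] by simp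
  next
    fix t assume t: "t \<in> {1..T}"
    show "AE \<omega> in M. (norm (g_theta t \<omega>))\<^sup>2 \<le> real CARD('d) * L\<^sup>2 \<and> (norm (g_lam t \<omega>))\<^sup>2 \<le> real CARD('m) * U\<^sup>2"
      using g_theta_bound[OF t] g_lam_bound[OF t]
      by eventually_elim (intro conjI norm_square_le_infnorm_cart)
  qed

  \<comment> \<open>The high-probability bound\<close>
  moreover have "1 - \<gamma> \<le> measure M {\<omega> \<in> space M.
               TCH f w (\<theta>hat \<omega>) - (INF x\<in>\<Theta>. TCH f w x)
                 \<le> 2 * sqrt 10 * real CARD('d) * R * L / sqrt (real T)
                   + 2 * sqrt 10 * sqrt (real CARD('m)) * U / sqrt (real T)
                   + 4 * (real CARD('d) * R * L + U) * sqrt (2 / real T * ln (1 / \<gamma>))}"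
    (is "_ \<le> measure M {\<omega> \<in> space M. ?gap \<omega> \<le> ?bound}")
    if \<eta>_theta: "\<eta>_theta = sqrt (8 * R\<^sup>2 / (5 * real T * L\<^sup>2))"
      and \<eta>_lam: "\<eta>_lam = sqrt (8 / (5 * real T * real CARD('m) * U\<^sup>2))"
      and \<gamma>: "0 < \<gamma>" "\<gamma> < 1" for \<gamma>
  proof -
    have T0: "0 < real T" using T by simp
    have \<eta>_pos: "0 < \<eta>_theta" "0 < \<eta>_lam" using pos T0 by (simp_all add: \<eta>_theta \<eta>_lam)

    \<comment> \<open>Conditional unbiasedness\<close>
    have g_theta_unbiased: "AE \<omega> in M. real_cond_exp M (F (t - 1)) (\<lambda>\<omega>. g_theta t \<omega> $ j) \<omega> = G_theta t \<omega> $ j"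
      if t: "t \<in> {1..T}" for t j
    proof -
      interpret sigma_finite_subalgebra M "F (t - 1)"
        using t by (intro sigma_finite_subalgebraI sub) auto
      have "AE \<omega> in M. real_cond_exp M (F (t - 1)) (\<lambda>\<omega>. \<Sum>i\<in>UNIV. lam t \<omega> $ i * w $ i * \<delta>f t i \<omega> $ j) \<omega>
          = (\<Sum>i\<in>UNIV. lam t \<omega> $ i * w $ i * gradient (f i) (\<theta> t \<omega>) $ j)"
      proof (rule real_cond_exp_weighted_sum[where b = 1])
        show "(\<lambda>\<omega>. lam t \<omega> $ i * w $ i) \<in> borel_measurable (F (t - 1))" for i
          using lam_pred[OF t] unfolding borel_measurable_cart_iff by (intro borel_measurable_times) auto
        show "\<bar>lam t \<omega> $ i * w $ i\<bar> \<le> 1" if "\<omega> \<in> space M" for i \<omega>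
          using lam_simplex[OF t that] simplex_set_component_le_1[OF lam_simplex[OF t that], of i] w0[of i] w1[of i]
          by (auto simp: simplex_set_def abs_mult intro: mult_le_one)
        show "integrable M (\<lambda>\<omega>. \<delta>f t i \<omega> $ j)" for i
          using integrable_bounded_linear[OF bounded_linear_vec_nth \<delta>f_int[OF t]] .
        show "AE \<omega> in M. real_cond_exp M (F (t - 1)) (\<lambda>\<omega>. \<delta>f t i \<omega> $ j) \<omega> = gradient (f i) (\<theta> t \<omega>) $ j" for i
          using \<delta>f_unbiased[OF t] by (simp add: F_def)
      qed
      then show ?thesis by (simp add: g_theta stoch_grad_theta_def G_theta_def)
    qed
    have g_lam_unbiased: "AE \<omega> in M. real_cond_exp M (F (t - 1)) (\<lambda>\<omega>. (- g_lam t \<omega>) $ j) \<omega> = (- G_lam t \<omega>) $ j"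
      if t: "t \<in> {1..T}" for t j
    proof -
      interpret sigma_finite_subalgebra M "F (t - 1)"
        using t by (intro sigma_finite_subalgebraI sub) auto
      show ?thesis
        using real_cond_exp_cmult[OF fhat_int[OF t], of "- w $ j" j] fhat_unbiased[OF t, of j]
        by eventually_elim (simp add: F_def g_lam stoch_grad_lam_def G_lam_def)
    qed

    \<comment> \<open>Size of the noise terms\<close>
    have noise_theta: "\<bar>v \<bullet> (y - z)\<bar> \<le> 4 * real CARD('d) * R * L"
      if "infnorm v \<le> 2 * L" "y \<in> \<Theta>" "z \<in> \<Theta>" for v y z
    proof -
      have "\<bar>(y - z) $ j\<bar> \<le> 2 * R" for j
        using component_le_infnorm_cart[of y j] component_le_infnorm_cart[of z j]
          Theta_bound[OF that(2)] Theta_bound[OF that(3)] by simp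
      then have "(\<Sum>j\<in>UNIV. \<bar>(y - z) $ j\<bar>) \<le> real CARD('d) * (2 * R)"
        using sum_mono[of UNIV "\<lambda>j. \<bar>(y - z) $ j\<bar>" "\<lambda>_. 2 * R"] by simp
      then have "2 * L * (\<Sum>j\<in>UNIV. \<bar>(y - z) $ j\<bar>) \<le> 2 * L * (real CARD('d) * (2 * R))"
        using pos by (intro mult_left_mono) auto
      from order_trans[OF abs_inner_le_infnorm_l1[OF that(1)] this] show ?thesis by (simp add: ac_simps)
    qed
    \<comment> \<open>Cauchy-Schwarz would cost a factor of order \<open>sqrt m\<close> here;
      pairing sup norm with l1 norm avoids it.\<close>
    have noise_lam: "\<bar>v \<bullet> (y - z)\<bar> \<le> 4 * U"
      if "infnorm v \<le> 2 * U" "y \<in> simplex_set" "z \<in> simplex_set" for v y z :: "real ^ 'm"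
      using order_trans[OF abs_inner_le_infnorm_l1[OF that(1)]
          mult_left_mono[OF sum_abs_diff_simplex_le[OF that(2,3)], of "2 * U"]] pos by simp

    have diam_init: "(norm (\<theta>1 - u))\<^sup>2 \<le> 2 * (2 * real CARD('d) * R\<^sup>2)" if "u \<in> \<Theta>" for u
      using diam_Theta[OF init(1) that] by simp
    have neg_bounds: "t \<in> {1..T} \<Longrightarrow> AE \<omega> in M. infnorm (- g_lam t \<omega>) \<le> U"
      "t \<in> {1..T} \<Longrightarrow> \<omega> \<in> space M \<Longrightarrow> infnorm (- G_lam t \<omega>) \<le> U" for t \<omega>
      using g_lam_bound G_lam_bound by (simp_all add: infnorm_neg)

    \<comment> \<open>Regret of both players\<close>
    obtain X where X: "\<And>t. t \<in> {1..T} \<Longrightarrow> X t \<in> borel_measurable (F t)"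
        "\<And>t. t \<in> {1..T} \<Longrightarrow> AE \<omega> in M. \<bar>X t \<omega>\<bar> \<le> 4 * real CARD('d) * R * L"
        "\<And>t. t \<in> {1..T} \<Longrightarrow> AE \<omega> in M. real_cond_exp M (F (t - 1)) (X t) \<omega> = 0"
      and X_regret: "AE \<omega> in M. \<forall>u\<in>\<Theta>. (\<Sum>t=1..T. G_theta t \<omega> \<bullet> (\<theta> t \<omega> - u))
           \<le> 2 * (2 * real CARD('d) * R\<^sup>2) / \<eta>_theta + 5 / 2 * \<eta>_theta * real T * real CARD('d) * L\<^sup>2 + (\<Sum>t=1..T. X t \<omega>)"
      using stochastic_projected_gradient_regret[where n = T, OF Theta(3,2) init(1) \<eta>_pos(1) sub mono init(2) g_theta_F
            \<theta>_update g_theta_bound G_theta_bound g_theta_unbiased diam_init noise_theta]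
      by blast
    obtain Y where Y: "\<And>t. t \<in> {1..T} \<Longrightarrow> Y t \<in> borel_measurable (F t)"
        "\<And>t. t \<in> {1..T} \<Longrightarrow> AE \<omega> in M. \<bar>Y t \<omega>\<bar> \<le> 4 * U"
        "\<And>t. t \<in> {1..T} \<Longrightarrow> AE \<omega> in M. real_cond_exp M (F (t - 1)) (Y t) \<omega> = 0"
      and Y_regret: "AE \<omega> in M. \<forall>v\<in>simplex_set. (\<Sum>t=1..T. - G_lam t \<omega> \<bullet> (lam t \<omega> - v))
           \<le> 2 * 2 / \<eta>_lam + 5 / 2 * \<eta>_lam * real T * real CARD('m) * U\<^sup>2 + (\<Sum>t=1..T. Y t \<omega>)"
      using stochastic_projected_gradient_regret[where n = T, OF convex_simplex_set closed_simplex_set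
            uniform_mem_simplex_set \<eta>_pos(2) sub mono init(3) g_lam_F lam_step neg_bounds g_lam_unbiased
            diam_simplex noise_lam]
      by blast

    \<comment> \<open>Concentration of the combined noise\<close>
    define c where "c = 4 * (real CARD('d) * R * L + U)"
    \<comment> \<open>Chosen so that the exponent in the tail bound becomes
      \<open>ln \<gamma>\<close>.\<close>
    define \<epsilon> where "\<epsilon> = c * sqrt (2 * real T * ln (1 / \<gamma>))"
    have c: "0 < c" using pos by (simp add: c_def add_pos_pos)
    have ln_pos: "0 < ln (1 / \<gamma>)" using \<gamma> by simp
    have \<epsilon>: "0 < \<epsilon>" using c ln_pos T0 by (simp add: \<epsilon>_def)
    have "prob {\<omega> \<in> space M. \<epsilon> \<le> (\<Sum>t=1..T. X t \<omega> + Y t \<omega>)} \<le> exp (- \<epsilon>\<^sup>2 / (2 * real T * c\<^sup>2))"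
    proof (rule azuma_hoeffding[of T F "\<lambda>t \<omega>. X t \<omega> + Y t \<omega>", OF T sub mono _ _ _ c \<epsilon>])
      fix t assume t: "t \<in> {1..T}"
      show "(\<lambda>\<omega>. X t \<omega> + Y t \<omega>) \<in> borel_measurable (F t)" using X(1)[OF t] Y(1)[OF t] by simp
      show "AE \<omega> in M. \<bar>X t \<omega> + Y t \<omega>\<bar> \<le> c"
        using X(2)[OF t] Y(2)[OF t] by eventually_elim (simp add: c_def)
      interpret sigma_finite_subalgebra M "F (t - 1)"
        using t by (intro sigma_finite_subalgebraI sub) auto
      have "subalgebra M (F t)" using sub t by simp
      then have "integrable M (X t)" "integrable M (Y t)"
        using X(1,2)[OF t] Y(1,2)[OF t]
        by (auto intro!: integrable_const_bound[of "X t"] integrable_const_bound[of "Y t"] intro: measurable_from_subalg)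
      from real_cond_exp_add[OF this]
      show "AE \<omega> in M. real_cond_exp M (F (t - 1)) (\<lambda>\<omega>. X t \<omega> + Y t \<omega>) \<omega> = 0"
        using X(3)[OF t] Y(3)[OF t] by eventually_elim simp
    qed simp_all
    also have "- \<epsilon>\<^sup>2 / (2 * real T * c\<^sup>2) = ln \<gamma>"
    proof -
      have "\<epsilon>\<^sup>2 = c\<^sup>2 * (2 * real T * ln (1 / \<gamma>))"
        unfolding \<epsilon>_def power_mult_distrib using ln_pos T0 by (subst real_sqrt_pow2) auto
      then show ?thesis using c T0 \<gamma> by (simp add: ln_div)
    qed
    also have "exp (ln \<gamma>) = \<gamma>" using \<gamma> by simp
    finally have tail: "prob {\<omega> \<in> space M. \<epsilon> \<le> (\<Sum>t=1..T. X t \<omega> + Y t \<omega>)} \<le> \<gamma>" .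

    \<comment> \<open>Effect of the step sizes\<close>
    have step_theta: "2 * (2 * real CARD('d) * R\<^sup>2) / \<eta>_theta + 5 / 2 * \<eta>_theta * real T * real CARD('d) * L\<^sup>2
        = 2 * sqrt 10 * real CARD('d) * R * L * sqrt (real T)"
    proof -
      have "2 * (2 * real CARD('d) * R\<^sup>2) / \<eta>_theta + 5 / 2 * \<eta>_theta * real T * real CARD('d) * L\<^sup>2
          = real CARD('d) * (4 * R\<^sup>2 / \<eta>_theta + 5 / 2 * \<eta>_theta * real T * L\<^sup>2)"
        by (simp add: algebra_simps)
      also have "\<dots> = real CARD('d) * (2 * sqrt 10 * sqrt (R\<^sup>2 * L\<^sup>2) * sqrt (real T))"
        unfolding \<eta>_theta using pos T0 by (subst optimal_step_size) auto
      finally show ?thesis using pos by (simp add: real_sqrt_mult)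
    qed
    have step_lam: "2 * 2 / \<eta>_lam + 5 / 2 * \<eta>_lam * real T * real CARD('m) * U\<^sup>2
        = 2 * sqrt 10 * sqrt (real CARD('m)) * U * sqrt (real T)"
      using optimal_step_size[of 1 "real CARD('m) * U\<^sup>2" "real T"] pos T0
      by (simp add: \<eta>_lam real_sqrt_mult mult.assoc)

    \<comment> \<open>From regret to the Tchebycheff gap\<close>
    have bdd: "bdd_below (TCH f w ` \<Theta>)"
    proof (rule bdd_belowI2)
      fix x assume x: "x \<in> \<Theta>"
      obtain i where "TCH f w x = w $ i * f i x" by (rule TCH_attained)
      then show "0 \<le> TCH f w x" using w0 f_nonneg[OF x] by simp
    qed
    define bad where "bad = {\<omega> \<in> space M. \<epsilon> \<le> (\<Sum>t=1..T. X t \<omega> + Y t \<omega>)}"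
    have AE_good: "AE \<omega> in M. \<omega> \<in> space M - bad \<longrightarrow> \<omega> \<in> {\<omega> \<in> space M. ?gap \<omega> \<le> ?bound}"
      using X_regret Y_regret AE_space
    proof eventually_elim
      case (elim \<omega>)
      show ?case
      proof
        assume "\<omega> \<in> space M - bad"
        then have lt: "(\<Sum>t=1..T. X t \<omega>) + (\<Sum>t=1..T. Y t \<omega>) \<le> \<epsilon>"
          by (auto simp: bad_def sum.distrib)
        \<comment> \<open>The bound is uniform in \<open>u\<close>, so the left side is a lower
          bound for all values on \<Theta> and hence for their infimum.\<close>
        have "TCH f w (\<theta>hat \<omega>) - ?bound \<le> TCH f w u" if u: "u \<in> \<Theta>" for u
        proof -
          have "real T * (TCH f w (\<theta>hat \<omega>) - TCH f w u)
              \<le> (2 * sqrt 10 * real CARD('d) * R * L * sqrt (real T) + (\<Sum>t=1..T. X t \<omega>))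
                + (2 * sqrt 10 * sqrt (real CARD('m)) * U * sqrt (real T) + (\<Sum>t=1..T. Y t \<omega>))"
            using elim(1,2) u unfolding step_theta step_lam G_theta_def G_lam_def
            by (intro TCH_gap_le_regret[where x = "\<lambda>t. \<theta> t \<omega>" and \<alpha> = "\<lambda>t. lam t \<omega>", OF T f_diff f_convex w0
                  \<theta>_Theta[OF _ elim(3)] lam_simplex[OF _ elim(3)] \<theta>hat_le[OF elim(3)]]) blast+
          also have "\<dots> \<le> 2 * sqrt 10 * real CARD('d) * R * L * sqrt (real T)
              + 2 * sqrt 10 * sqrt (real CARD('m)) * U * sqrt (real T) + \<epsilon>"
            using lt by simp
          also have "\<dots> = real T * ?bound"
          proof -
            have "real T * (a / sqrt (real T)) = a * sqrt (real T)" for a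
              using T0 by (simp add: field_simps)
            moreover have "real T * (c * sqrt (2 / real T * ln (1 / \<gamma>))) = \<epsilon>"
            proof -
              have "real T * sqrt (2 / real T * ln (1 / \<gamma>)) = sqrt ((real T)\<^sup>2 * (2 / real T * ln (1 / \<gamma>)))"
                by (simp only: real_sqrt_mult) simp
              also have "(real T)\<^sup>2 * (2 / real T * ln (1 / \<gamma>)) = 2 * real T * ln (1 / \<gamma>)"
                using T0 by (simp add: power2_eq_square)
              finally show ?thesis by (simp add: \<epsilon>_def)
            qed
            ultimately show ?thesis unfolding c_def[symmetric] unfolding distrib_left by simp
          qed
          finally show ?thesis using T0 by simp
        qed
        then have "TCH f w (\<theta>hat \<omega>) - ?bound \<le> (INF x\<in>\<Theta>. TCH f w x)"
          by (intro cINF_greatest Theta(1))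
        then show "\<omega> \<in> {\<omega> \<in> space M. ?gap \<omega> \<le> ?bound}" using elim(3) by simp
      qed
    qed
    \<comment> \<open>\<open>measure\<close> is 0 outside the sigma-algebra, so the inclusion up to
      a null set says nothing until the event of a small gap is known to be measurable. This is why
      measurability of the adaptive output had to be proved.\<close>
    have "(\<lambda>\<omega>. TCH f w (\<theta>hat \<omega>)) \<in> borel_measurable M"
      by (intro borel_measurable_TCH borel_measurable_comp_continuous_on[OF f_cont Theta(2)] \<theta>hat_M \<theta>hat_Theta)
    then have "{\<omega> \<in> space M. ?gap \<omega> \<le> ?bound} \<in> sets M"
      by (intro borel_measurable_le borel_measurable_diff borel_measurable_const)
    then have "prob (space M - bad) \<le> prob {\<omega> \<in> space M. ?gap \<omega> \<le> ?bound}"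
      by (rule finite_measure_mono_AE[OF AE_good])
    moreover have "bad \<in> sets M"
      unfolding bad_def
      by (intro borel_measurable_le borel_measurable_const borel_measurable_sum borel_measurable_add
          measurable_from_subalg[OF sub X(1)] measurable_from_subalg[OF sub Y(1)]) auto
    then have "1 - \<gamma> \<le> prob (space M - bad)"
      using tail unfolding bad_def[symmetric] by (simp add: prob_compl)
    ultimately show ?thesis by linarith
  qed
  ultimately show ?thesis by blast
qed

end
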